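(* Let $\lambda$ be an odd partition of $n$. If $n$ is even, then there exists a unique odd partition $\mu\in\lambda^+$. If $n$ is odd and $v=v_2(n+1)$, then $$|\lambda^+\cap\Lambda^{\mathrm{odd}}_{n+1}|=\begin{cases}2,&\text{if }\mathrm{core}_{2^v}(\lambda)\text{ is a hook},\\0,&\text{otherwise.}\end{cases}$$ In particular, the subgraph of Young's graph induced on $\Lambda^{\mathrm{odd}}$ is an (incomplete) binary tree.
   Context: For a partition $\lambda$, $f_\lambda$ is the number of standard Young tableaux of shape $\lambda$; $\lambda$ is odd if $f_\lambda$ is odd. $\Lambda^{\mathrm{odd}}$ is the set of odd partitions and $\Lambda^{\mathrm{odd}}_m$ those of size $m$. Young's graph is the Hasse diagram of Young's lattice (partitions ordered by containment of Young diagrams); $\lambda^+$ is the set of partitions covering $\lambda$ (obtained by adding one cell). $v_2$ is the $2$-adic valuation. For $p>1$, $\mathrm{core}_p(\lambda)$ is the $p$-core of $\lambda$, obtained by repeatedly removing rim hooks (border strips) of length $p$ until none remain. A hook is a partition of the form $(a+1,1^b)$ with $a,b\ge 0$. *)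

theory Defs
  imports "HOL-Library.FuncSet" "HOL-Computational_Algebra.Primes"
begin

definition is_partition :: "nat list \<Rightarrow> bool" where
  "is_partition lam \<longleftrightarrow> sorted_wrt (\<ge>) lam \<and> 0 \<notin> set lam"

(* Cells are zero-based pairs (row, column). *)
definition diagram :: "nat list \<Rightarrow> (nat \<times> nat) set" where
  "diagram lam = {(i, j). i < length lam \<and> j < lam ! i}"

definition standard_tableaux :: "nat list \<Rightarrow> (nat \<times> nat \<Rightarrow> nat) set" where
  "standard_tableaux lam = {T \<in> extensional (diagram lam).
     bij_betw T (diagram lam) {1..sum_list lam} \<and>
     (\<forall>i j. (i, Suc j) \<in> diagram lam \<longrightarrow> T (i, j) < T (i, Suc j)) \<and>
     (\<forall>i j. (Suc i, j) \<in> diagram lam \<longrightarrow> T (i, j) < T (Suc i, j))}"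

definition num_syt :: "nat list \<Rightarrow> nat" where
  "num_syt lam = card (standard_tableaux lam)"

definition odd_partitions :: "nat list set" where
  "odd_partitions = {lam. is_partition lam \<and> odd (num_syt lam)}"

definition odd_partitions_of :: "nat \<Rightarrow> nat list set" where
  "odd_partitions_of m = {lam \<in> odd_partitions. sum_list lam = m}"

definition upper_covers :: "nat list \<Rightarrow> nat list set" where
  "upper_covers lam = {mu. is_partition mu \<and> diagram lam \<subset> diagram mu \<and>
     \<not> (\<exists>nu. is_partition nu \<and> diagram lam \<subset> diagram nu \<and> diagram nu \<subset> diagram mu)}"

definition young_adj :: "nat list \<Rightarrow> nat list \<Rightarrow> bool" where
  "young_adj lam mu \<longleftrightarrow> is_partition lam \<and> is_partition mu \<and>
     (mu \<in> upper_covers lam \<or> lam \<in> upper_covers mu)"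

definition cell_adj :: "nat \<times> nat \<Rightarrow> nat \<times> nat \<Rightarrow> bool" where
  "cell_adj c d \<longleftrightarrow>
     (fst c = fst d \<and> (snd d = Suc (snd c) \<or> snd c = Suc (snd d))) \<or>
     (snd c = snd d \<and> (fst d = Suc (fst c) \<or> fst c = Suc (fst d)))"

definition cells_connected :: "(nat \<times> nat) set \<Rightarrow> bool" where
  "cells_connected S \<longleftrightarrow>
     (\<forall>c\<in>S. \<forall>d\<in>S. (c, d) \<in> {(a, b). a \<in> S \<and> b \<in> S \<and> cell_adj a b}\<^sup>*)"

definition contains_square :: "(nat \<times> nat) set \<Rightarrow> bool" where
  "contains_square S \<longleftrightarrow> (\<exists>i j. {(i, j), (i, Suc j), (Suc i, j), (Suc i, Suc j)} \<subseteq> S)"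

(* mu arises from lam by removing one rim hook (a connected skew shape without
   2-by-2 square) of p cells. *)
definition removes_rim_hook :: "nat \<Rightarrow> nat list \<Rightarrow> nat list \<Rightarrow> bool" where
  "removes_rim_hook p lam mu \<longleftrightarrow> is_partition lam \<and> is_partition mu \<and>
     diagram mu \<subseteq> diagram lam \<and>
     card (diagram lam - diagram mu) = p \<and>
     cells_connected (diagram lam - diagram mu) \<and>
     \<not> contains_square (diagram lam - diagram mu)"

definition p_core :: "nat \<Rightarrow> nat list \<Rightarrow> nat list" where
  "p_core p lam = (THE mu. (removes_rim_hook p)\<^sup>*\<^sup>* lam mu \<and>
     \<not> (\<exists>nu. removes_rim_hook p mu nu))"

definition is_hook :: "nat list \<Rightarrow> bool" where
  "is_hook lam \<longleftrightarrow> (\<exists>a b. lam = (a + 1) # replicate b 1)"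

(* Undirected graphs are given by a vertex set V and an adjacency relation E, of which
   only the restriction to V matters; taking a subset V of the vertices of a larger
   graph therefore yields the induced subgraph. *)
definition simple_path :: "'a set \<Rightarrow> ('a \<Rightarrow> 'a \<Rightarrow> bool) \<Rightarrow> 'a list \<Rightarrow> bool" where
  "simple_path V E xs \<longleftrightarrow> xs \<noteq> [] \<and> set xs \<subseteq> V \<and> distinct xs \<and> successively E xs"

definition connected_graph :: "'a set \<Rightarrow> ('a \<Rightarrow> 'a \<Rightarrow> bool) \<Rightarrow> bool" where
  "connected_graph V E \<longleftrightarrow> V \<noteq> {} \<and>
     (\<forall>u\<in>V. \<forall>w\<in>V. \<exists>xs. simple_path V E xs \<and> hd xs = u \<and> last xs = w)"

definition acyclic_graph :: "'a set \<Rightarrow> ('a \<Rightarrow> 'a \<Rightarrow> bool) \<Rightarrow> bool" where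
  "acyclic_graph V E \<longleftrightarrow>
     \<not> (\<exists>xs. simple_path V E xs \<and> length xs \<ge> 3 \<and> E (last xs) (hd xs))"

definition tree_graph :: "'a set \<Rightarrow> ('a \<Rightarrow> 'a \<Rightarrow> bool) \<Rightarrow> bool" where
  "tree_graph V E \<longleftrightarrow> connected_graph V E \<and> acyclic_graph V E"

(* In a tree: the neighbours w of u such that the path from the root r to w ends
   with the edge from u to w. *)
definition children :: "'a set \<Rightarrow> ('a \<Rightarrow> 'a \<Rightarrow> bool) \<Rightarrow> 'a \<Rightarrow> 'a \<Rightarrow> 'a set" where
  "children V E r u = {w. \<exists>xs. simple_path V E (xs @ [w]) \<and> xs \<noteq> [] \<and> hd xs = r \<and> last xs = u}"

definition binary_tree :: "'a set \<Rightarrow> ('a \<Rightarrow> 'a \<Rightarrow> bool) \<Rightarrow> 'a \<Rightarrow> bool" where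
  "binary_tree V E r \<longleftrightarrow> tree_graph V E \<and> r \<in> V \<and>
     (\<forall>u\<in>V. finite (children V E r u) \<and> card (children V E r u) \<le> 2)"

definition incomplete_binary_tree :: "'a set \<Rightarrow> ('a \<Rightarrow> 'a \<Rightarrow> bool) \<Rightarrow> 'a \<Rightarrow> bool" where
  "incomplete_binary_tree V E r \<longleftrightarrow> binary_tree V E r \<and>
     (\<exists>u\<in>V. card (children V E r u) < 2)"

end

theory Submission
  imports Defs "HOL-Library.Z2"
begin

text \<open>
  Encode partitions by their beta-sets, so that removing a rim hook of length \<open>r\<close> slides one bead
  down from \<open>a + r\<close> to an empty position \<open>a\<close>. Modulo 2, summing over all slides by \<open>r\<close> twice is the
  same as summing over all slides by \<open>2 r\<close>, because slides of two independent beads cancel in pairs.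
  Hence the number of standard tableaux satisfies the branching rule modulo 2 also with rim hooks of
  length \<open>2 ^ k\<close> in place of single cells. For \<open>n = 2 ^ k + m\<close> with \<open>m < 2 ^ k\<close> there is at most
  one such hook, so a partition of \<open>n\<close> is odd iff it has a rim hook of length \<open>2 ^ k\<close> whose removal
  leaves an odd partition of \<open>m\<close>.

  On the \<open>2 ^ k\<close>-abacus, the odd covers of an odd partition of \<open>n\<close> correspond bijectively to those of
  its \<open>2 ^ k\<close>-core as long as \<open>m + 1 < 2 ^ k\<close>. Iterating this leads to \<open>n + 1 = 2 ^ v\<close>, where the odd
  partitions of \<open>2 ^ v\<close> are exactly the hooks. The same correspondence, read downwards, shows that an
  odd partition covers only one odd partition, which makes the graph a tree.
\<close>

subsection \<open>Partitions and diagrams\<close>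

text \<open>The squaring step is the congruence p_r^2 = p_{2r} modulo 2 between power sums, read
  through the Murnaghan-Nakayama rule, whose signs vanish modulo 2. The delicate point is comparing
  the cores of partitions of \<open>n\<close> and \<open>n + 1\<close>. Each has a single bead that
  can slide by \<open>2 ^ k\<close>, but adding a cell may move that very bead or fill the gap below
  it, so the two gaps need not agree; \<open>swapped\<close> records how they differ. The comparison
  needs \<open>n\<close> and \<open>n + 1\<close> to have the same leading binary digit, which fails
  only when \<open>n + 1\<close> is a power of 2. The descent therefore strips the leading digits of
  \<open>n\<close> until only its \<open>v\<close> trailing ones are left. Every length removed on
  the way is a multiple of \<open>2 ^ v\<close>, so each slide splits into slides by
  \<open>2 ^ v\<close>, and the remainder, of size \<open>2 ^ v - 1\<close>, is the
  \<open>2 ^ v\<close>-core. Even \<open>n\<close> is the case \<open>v = 0\<close>: the core is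
  empty and has the single odd cover \<open>[1]\<close>.\<close>

definition row :: "nat list \<Rightarrow> nat \<Rightarrow> nat" where
  "row lam i = (if i < length lam then lam ! i else 0)"

lemma mem_diagram: "(i, j) \<in> diagram lam \<longleftrightarrow> j < row lam i"
  by (auto simp: diagram_def row_def)

lemma row_antimono:
  assumes "is_partition lam" "i \<le> k"
  shows "row lam k \<le> row lam i"
  using assms by (cases "i = k") (auto simp: row_def is_partition_def sorted_wrt_iff_nth_less)

lemma row_pos_iff: "is_partition lam \<Longrightarrow> 0 < row lam i \<longleftrightarrow> i < length lam"
  by (auto simp: row_def is_partition_def in_set_conv_nth intro!: gr0I)

lemma diagram_down:
  assumes "is_partition lam" "(i, j) \<in> diagram lam" "i' \<le> i" "j' \<le> j"
  shows "(i', j') \<in> diagram lam"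
  using row_antimono[OF assms(1,3)] assms(2,4) by (auto simp: mem_diagram)

lemma finite_diagram [simp]: "finite (diagram lam)"
  and card_diagram: "card (diagram lam) = sum_list lam"
proof -
  have *: "diagram lam = Sigma {..<length lam} (\<lambda>i. {..<lam ! i})"
    by (auto simp: diagram_def)
  show "finite (diagram lam)" unfolding * by auto
  show "card (diagram lam) = sum_list lam"
    unfolding * by (simp add: sum_list_sum_nth atLeast0LessThan)
qed

lemma partition_eqI:
  assumes "is_partition lam" "is_partition mu" "\<And>i. row lam i = row mu i"
  shows "lam = mu"
proof (rule nth_equalityI)
  have "i < length lam \<longleftrightarrow> i < length mu" for i
    using assms by (metis row_pos_iff)
  then show *: "length lam = length mu"
    by (metis linorder_neqE_nat less_irrefl)
  show "lam ! i = mu ! i" if "i < length lam" for i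
    using assms(3)[of i] that * by (simp add: row_def)
qed

lemma diagram_subset_iff: "diagram mu \<subseteq> diagram lam \<longleftrightarrow> (\<forall>i. row mu i \<le> row lam i)"
proof
  assume *: "diagram mu \<subseteq> diagram lam"
  show "\<forall>i. row mu i \<le> row lam i"
  proof
    fix i show "row mu i \<le> row lam i"
    proof (rule ccontr)
      assume "\<not> ?thesis"
      then have "(i, row lam i) \<in> diagram mu" by (simp add: mem_diagram)
      then have "(i, row lam i) \<in> diagram lam" using * by blast
      then show False by (simp add: mem_diagram)
    qed
  qed
next
  assume *: "\<forall>i. row mu i \<le> row lam i"
  show "diagram mu \<subseteq> diagram lam"
  proof
    fix c assume "c \<in> diagram mu"
    then show "c \<in> diagram lam"
      using *[rule_format, of "fst c"] by (cases c) (simp add: mem_diagram)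
  qed
qed

lemma diagram_inj:
  assumes "is_partition lam" "is_partition mu" "diagram lam = diagram mu"
  shows "lam = mu"
  using assms(1,2)
proof (rule partition_eqI)
  show "row lam i = row mu i" for i
    using diagram_subset_iff[of lam mu] diagram_subset_iff[of mu lam] assms(3)
    by (simp add: antisym)
qed

lemma partition_of_rows:
  assumes anti: "\<And>i. p (Suc i) \<le> p i" and "p L = (0::nat)"
  obtains lam where "is_partition lam" "row lam = p" "length lam \<le> L"
proof
  \<comment> \<open>Cutting at the first zero keeps \<open>0\<close> out of the list, as
    \<open>is_partition\<close> demands.\<close>
  define M where "M = (LEAST L. p L = 0)"
  let ?lam = "map p [0..<M]"
  have mono: "p k \<le> p i" if "i \<le> k" for i k
    using that by (induction k rule: dec_induct) (auto intro: order_trans anti)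
  have M0: "p M = 0" unfolding M_def using assms(2) by (rule LeastI)
  have Mpos: "p i \<noteq> 0" if "i < M" for i
    using that not_less_Least unfolding M_def by blast
  show "is_partition ?lam"
    using Mpos by (fastforce simp: is_partition_def sorted_wrt_iff_nth_less mono)
  show "row ?lam = p"
    using mono[of M] M0 by (auto simp: row_def fun_eq_iff not_less)
  show "length ?lam \<le> L"
    using assms(2) by (simp add: M_def Least_le)
qed

lemma down_set_eq_lessThan:
  assumes "finite (X :: nat set)" "\<And>j j'. j \<in> X \<Longrightarrow> j' \<le> j \<Longrightarrow> j' \<in> X"
  shows "X = {..<card X}"
proof -
  obtain n where n: "X = {..<n}"
  proof (cases "X = {}")
    case False
    then have "X = {..Max X}"
      using assms by (auto intro: Max_in)
    then show ?thesis using that[of "Suc (Max X)"] lessThan_Suc_atMost by simp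
  qed (use that[of 0] in auto)
  then show ?thesis by simp
qed

lemma partition_of_diagram:
  assumes fin: "finite D"
    and down: "\<And>i j i' j'. (i, j) \<in> D \<Longrightarrow> i' \<le> i \<Longrightarrow> j' \<le> j \<Longrightarrow> (i', j') \<in> D"
  obtains lam where "is_partition lam" "diagram lam = D"
proof -
  define R where "R i = {j. (i, j) \<in> D}" for i
  have finR: "finite (R i)" for i
    by (rule finite_subset[of _ "snd ` D"]) (use fin in \<open>force simp: R_def\<close>)+
  have R: "R i = {..<card (R i)}" for i
    using finR down by (intro down_set_eq_lessThan) (auto simp: R_def)
  have anti: "card (R (Suc i)) \<le> card (R i)" for i
    by (intro card_mono finR) (use down in \<open>auto simp: R_def intro: le_SucI\<close>)
  obtain L where "L \<notin> fst ` D"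
    using ex_new_if_finite[of "fst ` D"] fin by auto
  then have "R L = {}"
    by (force simp: R_def)
  then have "card (R L) = 0" by simp
  from partition_of_rows[of "\<lambda>i. card (R i)", OF anti this]
  obtain lam where lam: "is_partition lam" "row lam = (\<lambda>i. card (R i))" .
  have "(i, j) \<in> diagram lam \<longleftrightarrow> (i, j) \<in> D" for i j
  proof -
    have "j \<in> R i \<longleftrightarrow> j < card (R i)" using arg_cong[OF R[of i], of "\<lambda>X. j \<in> X"] by simp
    then show ?thesis using lam(2) by (simp add: mem_diagram R_def)
  qed
  then have "diagram lam = D" by auto
  with lam(1) show ?thesis by (rule that)
qed

lemma length_le_of_subset:
  assumes "is_partition lam" "is_partition mu" "diagram mu \<subseteq> diagram lam"
  shows "length mu \<le> length lam"
proof (rule ccontr)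
  assume "\<not> ?thesis"
  then have "0 < row mu (length lam)" using assms(2) by (simp add: row_pos_iff)
  then show False
    using assms(3) by (auto simp: diagram_subset_iff row_def dest!: spec[of _ "length lam"])
qed

lemma length_le_sum_list: "is_partition lam \<Longrightarrow> length lam \<le> sum_list lam"
proof (induction lam)
  case (Cons a lam)
  then have "length lam \<le> sum_list lam" "0 < a"
    by (simp_all add: is_partition_def)
  then show ?case by simp
qed simp

lemma sum_list_eq_0_partition: "is_partition lam \<Longrightarrow> sum_list lam = 0 \<longleftrightarrow> lam = []"
  by (cases lam) (auto simp: is_partition_def)

subsection \<open>Beta-sets\<close>

text \<open>Faithful only for partitions with at most \<open>N\<close> rows; further rows are silently dropped.\<close>

definition bset :: "nat \<Rightarrow> nat list \<Rightarrow> nat set" where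
  "bset N lam = (\<lambda>i. row lam i + (N - Suc i)) ` {..<N}"

lemma finite_bset [simp]: "finite (bset N lam)"
  by (simp add: bset_def)

lemma bset_inj_on:
  assumes "is_partition lam"
  shows "inj_on (\<lambda>i. row lam i + (N - Suc i)) {..<N}"
proof (rule linorder_inj_onI)
  fix i k assume "i < k" "i \<in> {..<N}" "k \<in> {..<N}"
  then show "row lam i + (N - Suc i) \<noteq> row lam k + (N - Suc k)"
    using row_antimono[OF assms, of i k] by auto
qed auto

lemma card_bset: "is_partition lam \<Longrightarrow> card (bset N lam) = N"
  unfolding bset_def by (subst card_image[OF bset_inj_on]) auto

lemma sum_bset:
  assumes "is_partition lam" "length lam \<le> N"
  shows "\<Sum>(bset N lam) = sum_list lam + \<Sum>{..<N}"
proof -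
  have "\<Sum>(bset N lam) = (\<Sum>i<N. row lam i) + (\<Sum>i<N. N - Suc i)"
    unfolding bset_def sum.reindex[OF bset_inj_on[OF assms(1)]] by (simp only: o_def sum.distrib)
  also have "(\<Sum>i<N. N - Suc i) = \<Sum>{..<N}"
    using sum.nat_diff_reindex[of "\<lambda>i. i" N] by simp
  also have "(\<Sum>i<N. row lam i) = (\<Sum>i<length lam. row lam i)"
    by (rule sum.mono_neutral_right) (use assms in \<open>auto simp: row_def\<close>)
  also have "\<dots> = sum_list lam"
    by (simp add: sum_list_sum_nth atLeast0LessThan row_def)
  finally show ?thesis .
qed

lemma bset_Nil: "bset N [] = {..<N}"
proof -
  have "x \<in> bset N []" if "x < N" for x
    using that by (auto simp: bset_def row_def intro!: image_eqI[of _ _ "N - Suc x"])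
  then show ?thesis by (auto simp: bset_def row_def)
qed

lemma partition_of_bset:
  assumes "finite S" "card S = N"
  obtains lam where "is_partition lam" "length lam \<le> N" "bset N lam = S"
proof -
  define xs where "xs = sorted_list_of_set S"
  have len: "length xs = N" and set: "set xs = S"
    using assms by (auto simp: xs_def)
  have less: "xs ! i < xs ! j" if "i < j" "j < N" for i j
    using that len strict_sorted_list_of_set[of S]
    by (auto simp: xs_def sorted_wrt_iff_nth_less)
  have ge: "k \<le> xs ! k" if "k < N" for k
    using that by (induction k) (use less[of "_" "Suc _"] in \<open>auto simp: Suc_le_eq intro: le_less_trans\<close>)
  \<comment> \<open>The bead of rank \<open>k\<close> from below has \<open>xs ! k - k\<close> empty
    positions under it, and this number is the length of its row; \<open>ge\<close> makes the
    subtraction exact.\<close>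
  define p where "p i = (if i < N then xs ! (N - Suc i) - (N - Suc i) else 0)" for i
  have "p (Suc i) \<le> p i" for i
  proof (cases "Suc i < N")
    case True
    then have "xs ! (N - Suc (Suc i)) < xs ! (N - Suc i)" by (intro less) auto
    then show ?thesis using True by (auto simp: p_def)
  qed (simp add: p_def)
  moreover have "p N = 0" by (simp add: p_def)
  ultimately obtain lam where lam: "is_partition lam" "row lam = p" "length lam \<le> N"
    by (rule partition_of_rows)
  have "bset N lam = (\<lambda>i. xs ! (N - Suc i)) ` {..<N}"
    unfolding bset_def lam(2) proof (intro image_cong refl)
    fix i assume "i \<in> {..<N}"
    then show "p i + (N - Suc i) = xs ! (N - Suc i)"
      using ge[of "N - Suc i"] by (simp add: p_def)
  qed
  also have "\<dots> = (!) xs ` ((\<lambda>i. N - Suc i) ` {..<N})"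
    by (simp add: image_image)
  also have "(\<lambda>i. N - Suc i) ` {..<N} = {..<N}"
    using bset_Nil[of N] by (simp add: bset_def row_def)
  also have "(!) xs ` {..<N} = S"
    using set len by (auto simp: set_conv_nth)
  finally show ?thesis using that lam by blast
qed

section \<open>Counting beads along the diagonals of a diagram\<close>

text \<open>These cells have content \<open>e - N\<close>; the additive equation avoids truncated
  subtraction.\<close>

definition diag :: "nat \<Rightarrow> nat \<Rightarrow> (nat \<times> nat) set \<Rightarrow> (nat \<times> nat) set" where
  "diag N e D = {c \<in> D. snd c + N = fst c + e}"

definition count_from :: "nat set \<Rightarrow> nat \<Rightarrow> nat" where
  "count_from S e = card {x \<in> S. e \<le> x}"

lemma finite_diag [simp]: "finite D \<Longrightarrow> finite (diag N e D)"
  by (simp add: diag_def)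

text \<open>The bead of row \<open>i\<close> lies at or above \<open>e\<close> iff that row reaches
  past column \<open>i + e - N\<close>. For \<open>i < N - e\<close> this column would be negative,
  so these rows count without owning a cell of the diagonal; every other such row owns exactly
  one.\<close>

lemma count_from_bset:
  assumes "is_partition lam" "length lam \<le> N"
  shows "count_from (bset N lam) e = card (diag N e (diagram lam)) + (N - e)"
proof -
  let ?b = "\<lambda>i. row lam i + (N - Suc i)"
  let ?I = "{i. i < N \<and> e \<le> ?b i}"
  have "{x \<in> bset N lam. e \<le> x} = ?b ` ?I"
    by (auto simp: bset_def)
  then have "count_from (bset N lam) e = card ?I"
    unfolding count_from_def
    using card_image[OF inj_on_subset[OF bset_inj_on[OF assms(1)]], of ?I N] by auto
  also have "?I = fst ` diag N e (diagram lam) \<union> {..<N - e}"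
  proof (intro set_eqI iffI)
    fix i assume i: "i \<in> ?I"
    show "i \<in> fst ` diag N e (diagram lam) \<union> {..<N - e}"
    proof (cases "i < N - e")
      case False
      then have "(i, i + e - N) \<in> diag N e (diagram lam)"
        using i by (auto simp: diag_def mem_diagram)
      then show ?thesis by force
    qed simp
  next
    fix i assume i: "i \<in> fst ` diag N e (diagram lam) \<union> {..<N - e}"
    show "i \<in> ?I"
    proof (cases "i < N - e")
      case False
      with i obtain j where j: "j < row lam i" "j + N = i + e"
        by (auto simp: diag_def mem_diagram)
      then have "i < N" using assms by (metis row_pos_iff gr_implies_not0 neq0_conv less_le_trans)
      then show ?thesis using j by auto
    qed auto
  qed
  also have "card \<dots> = card (fst ` diag N e (diagram lam)) + card {..<N - e}"
    by (rule card_Un_disjoint) (auto simp: diag_def)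
  also have "card (fst ` diag N e (diagram lam)) = card (diag N e (diagram lam))"
    by (rule card_image) (auto simp: inj_on_def diag_def)
  finally show ?thesis by simp
qed

lemma count_from_Suc: "finite S \<Longrightarrow> count_from S x = count_from S (Suc x) + (if x \<in> S then 1 else 0)"
proof -
  assume fin: "finite S"
  have "{y \<in> S. x \<le> y} = (if x \<in> S then insert x {y \<in> S. Suc x \<le> y} else {y \<in> S. Suc x \<le> y})"
    by (auto simp: Suc_le_eq order_le_less)
  then show ?thesis using fin by (simp add: count_from_def)
qed

text \<open>On each diagonal the cells of a partition form an initial segment, so containment can be
  tested by counting: if \<open>c\<close> is missing from \<open>lam\<close>, all cells of
  \<open>lam\<close> on its diagonal precede \<open>c\<close>, hence lie in \<open>mu\<close>, and
  \<open>mu\<close> has strictly more.\<close>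

lemma diag_subsetI:
  assumes lam: "is_partition lam" and mu: "is_partition mu"
    and le: "\<And>e. card (diag N e (diagram mu)) \<le> card (diag N e (diagram lam))"
    and len: "length mu \<le> N"
  shows "diagram mu \<subseteq> diagram lam"
proof (rule subsetI, rule ccontr)
  fix c assume c: "c \<in> diagram mu" "c \<notin> diagram lam"
  obtain i j where ij: "c = (i, j)" by (cases c)
  have "i < N"
    using c ij len mu by (metis mem_diagram row_pos_iff gr_implies_not0 neq0_conv less_le_trans)
  define e where "e = j + N - i"
  have ce: "c \<in> diag N e (diagram mu)"
    using c \<open>i < N\<close> by (simp add: diag_def ij e_def)
  have "diag N e (diagram lam) \<subseteq> diag N e (diagram mu) - {c}"
  proof
    fix d assume d: "d \<in> diag N e (diagram lam)"
    obtain i' j' where ij': "d = (i', j')" by (cases d)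
    have eq: "j' + N = i' + e" "j + N = i + e"
      using d ce by (auto simp: diag_def ij ij')
    have "\<not> i \<le> i'"
      using diagram_down[OF lam, of i' j' i j] d c eq by (auto simp: diag_def ij ij')
    then have "d \<in> diagram mu"
      using diagram_down[OF mu, of i j i' j'] c eq by (auto simp: ij ij')
    then show "d \<in> diag N e (diagram mu) - {c}"
      using eq \<open>\<not> i \<le> i'\<close> by (auto simp: diag_def ij ij')
  qed
  then have "card (diag N e (diagram lam)) < card (diag N e (diagram mu))"
    using ce by (intro psubset_card_mono) auto
  then show False using le[of e] by simp
qed

lemma bset_inj:
  assumes "is_partition lam" "is_partition mu" "length lam \<le> N" "length mu \<le> N"
    and "bset N lam = bset N mu"
  shows "lam = mu"
proof -
  have "card (diag N e (diagram lam)) = card (diag N e (diagram mu))" for e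
    using count_from_bset[of lam N e] count_from_bset[of mu N e] assms by simp
  then show ?thesis
    using assms by (intro diagram_inj antisym diag_subsetI[of _ _ N]) auto
qed

subsection \<open>Rim hooks as bead slides\<close>

definition gaps :: "nat \<Rightarrow> nat set \<Rightarrow> nat set" where
  "gaps r S = {a. a \<notin> S \<and> a + r \<in> S}"

definition slide :: "nat \<Rightarrow> nat \<Rightarrow> nat set \<Rightarrow> nat set" where
  "slide r a S = insert a (S - {a + r})"

text \<open>Membership of \<open>x\<close> is the drop of the tail count from \<open>x\<close> to
  \<open>Suc x\<close>, so tail counts determine a finite set. In this form a slide can be compared
  with diagonal counts of diagrams.\<close>

lemma count_from_move:
  assumes "finite S" "finite T" "0 < r"
  shows "(\<forall>e. count_from S e = count_from T e + (if a < e \<and> e \<le> a + r then 1 else 0))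
    \<longleftrightarrow> a \<in> gaps r S \<and> T = slide r a S"
proof
  assume L: "\<forall>e. count_from S e = count_from T e + (if a < e \<and> e \<le> a + r then 1 else 0)"
  have mem: "(if x \<in> S then 1 else 0) + (if a < Suc x \<and> Suc x \<le> a + r then 1 else 0) =
      (if x \<in> T then 1 else 0) + (if a < x \<and> x \<le> a + r then 1 else (0::nat))" for x
    using L[rule_format, of x] L[rule_format, of "Suc x"] count_from_Suc[OF assms(1), of x]
      count_from_Suc[OF assms(2), of x] by linarith
  have "a \<notin> S" "a + r \<in> S"
    using mem[of a] mem[of "a + r"] assms(3) by (auto split: if_splits)
  moreover have "x \<in> T \<longleftrightarrow> x = a \<or> x \<in> S \<and> x \<noteq> a + r" for x
    using mem[of x] assms(3) calculation by (auto split: if_splits)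
  ultimately show "a \<in> gaps r S \<and> T = slide r a S"
    by (auto simp: gaps_def slide_def)
next
  assume R: "a \<in> gaps r S \<and> T = slide r a S"
  then have a: "a \<notin> S" "a + r \<in> S" by (auto simp: gaps_def)
  show "\<forall>e. count_from S e = count_from T e + (if a < e \<and> e \<le> a + r then 1 else 0)"
  proof
    fix e
    define X where "X = {x \<in> S. e \<le> x} - {a + r}"
    have fin: "finite X" using assms by (simp add: X_def)
    have X: "a \<notin> X" "a + r \<notin> X" using a by (auto simp: X_def)
    have S: "{x \<in> S. e \<le> x} = (if e \<le> a + r then insert (a + r) X else X)"
      using a by (auto simp: X_def)
    have T: "{x \<in> T. e \<le> x} = (if e \<le> a then insert a X else X)"
      using R by (auto simp: slide_def X_def)
    have "count_from S e = card X + (if e \<le> a + r then 1 else 0)"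
      unfolding count_from_def S using fin X by simp
    moreover have "count_from T e = card X + (if e \<le> a then 1 else 0)"
      unfolding count_from_def T using fin X by simp
    ultimately show "count_from S e = count_from T e + (if a < e \<and> e \<le> a + r then 1 else 0)"
      by auto
  qed
qed

text \<open>The content of a cell, shifted by \<open>N\<close> to keep it nonnegative on diagrams with at most
  \<open>N\<close> rows.\<close>

definition cont :: "nat \<Rightarrow> nat \<times> nat \<Rightarrow> nat" where
  "cont N c = snd c + N - fst c"

lemma cell_row_less:
  "is_partition lam \<Longrightarrow> length lam \<le> N \<Longrightarrow> c \<in> diagram lam \<Longrightarrow> fst c < N"
  by (auto simp: diagram_def)

lemma skew_convex:
  assumes "is_partition lam" "is_partition mu"
    and "(i, j) \<in> diagram lam - diagram mu" "(i', j') \<in> diagram lam - diagram mu"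
    and "i \<le> k" "k \<le> i'" "j \<le> l" "l \<le> j'"
  shows "(k, l) \<in> diagram lam - diagram mu"
  using diagram_down[OF assms(1), of i' j' k l] diagram_down[OF assms(2), of k l i j] assms(3-)
  by auto

lemma cell_adj_sym: "cell_adj c d \<Longrightarrow> cell_adj d c"
  by (auto simp: cell_adj_def)

text \<open>A step to an adjacent cell changes the content by exactly one, so a path cannot skip a
  content.\<close>

lemma connected_contents:
  assumes lam: "is_partition lam" "length lam \<le> N"
    and path: "(c, d) \<in> {(a, b). a \<in> K \<and> b \<in> K \<and> cell_adj a b}\<^sup>*" "c \<in> K"
    and K: "K \<subseteq> diagram lam"
  shows "d \<in> K \<and> {cont N c..cont N d} \<union> {cont N d..cont N c} \<subseteq> cont N ` K"
  using path
proof (induction rule: rtrancl_induct)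
  case (step d z)
  have "fst d < N" "fst z < N"
    using step K by (blast intro: cell_row_less[OF lam])+
  then have "cont N z = Suc (cont N d) \<or> cont N d = Suc (cont N z)"
    using step(2) by (auto simp: cell_adj_def cont_def)
  then have "{cont N c..cont N z} \<union> {cont N z..cont N c} \<subseteq>
     insert (cont N z) ({cont N c..cont N d} \<union> {cont N d..cont N c})"
    by auto
  then show ?case using step by blast
qed auto

text \<open>Absence of squares means that each diagonal is met at most once, and connectedness then
  means that the diagonals met form an interval. Contents thus replace the geometry of the rim
  hook.\<close>

lemma removes_rim_hook_contents:
  assumes lam: "is_partition lam" "length lam \<le> N" and p: "0 < p"
  shows "removes_rim_hook p lam mu \<longleftrightarrow> is_partition mu \<and> diagram mu \<subseteq> diagram lam \<and>
    inj_on (cont N) (diagram lam - diagram mu) \<and>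
    (\<exists>a. cont N ` (diagram lam - diagram mu) = {a<..a + p})"
proof
  let ?K = "diagram lam - diagram mu"
  assume R: "removes_rim_hook p lam mu"
  then have mu: "is_partition mu" "diagram mu \<subseteq> diagram lam" and card: "card ?K = p"
    and conn: "cells_connected ?K" and sq: "\<not> contains_square ?K"
    by (auto simp: removes_rim_hook_def)
  have rN: "fst c < N" if "c \<in> ?K" for c
    using that cell_row_less[OF lam] by auto
  \<comment> \<open>Two cells of the skew shape on one diagonal would enclose a square, by
    convexity.\<close>
  have False if c: "(i, j) \<in> ?K" "(i', j') \<in> ?K" "i < i'" "cont N (i, j) = cont N (i', j')" for i j i' j'
  proof -
    have "j < j'" using c rN[OF c(1)] rN[OF c(2)] by (auto simp: cont_def)
    then have "{(i, j), (i, Suc j), (Suc i, j), (Suc i, Suc j)} \<subseteq> ?K"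
      using c(3) skew_convex[OF lam(1) mu(1) c(1) c(2)] by simp
    then show False using sq unfolding contains_square_def by blast
  qed
  note aux = this
  have inj: "inj_on (cont N) ?K"
  proof (rule inj_onI)
    fix c d assume c: "c \<in> ?K" "d \<in> ?K" "cont N c = cont N d"
    obtain i j i' j' where ij: "c = (i, j)" "d = (i', j')" by (cases c, cases d)
    have "i = i'" using aux[of i j i' j'] aux[of i' j' i j] c ij by (metis linorder_neqE_nat)
    then show "c = d" using c(3) rN[OF c(1)] ij by (simp add: cont_def)
  qed
  define I where "I = cont N ` ?K"
  have I: "finite I" "I \<noteq> {}" "card I = p"
  proof -
    show "card I = p" using card inj by (simp add: I_def card_image)
    then show "finite I" "I \<noteq> {}" using p by (auto intro: card_ge_0_finite)
  qed
  have between: "{x..y} \<subseteq> I" if xy: "x \<in> I" "y \<in> I" for x y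
  proof -
    obtain c d where cd: "c \<in> ?K" "d \<in> ?K" "x = cont N c" "y = cont N d"
      using xy by (auto simp: I_def)
    then have "(c, d) \<in> {(a, b). a \<in> ?K \<and> b \<in> ?K \<and> cell_adj a b}\<^sup>*"
      using conn unfolding cells_connected_def by blast
    from connected_contents[OF lam this cd(1)] show ?thesis by (simp add: cd I_def)
  qed
  define lo hi where "lo = Min I" and "hi = Max I"
  have Ieq: "I = {lo..hi}"
    using between[of "Min I" "Max I"] I by (auto simp: lo_def hi_def)
  have "lo \<in> I" using I by (simp add: lo_def)
  then obtain c where "c \<in> ?K" "lo = cont N c" by (auto simp: I_def)
  \<comment> \<open>Positivity matters: the half-open interval starts at \<open>lo - 1\<close>,
    which must not be truncated.\<close>
  then have "0 < lo"
    using rN[of c] by (simp add: cont_def)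
  moreover have "Suc hi - lo = p"
    using I(3) unfolding Ieq by simp
  ultimately have "I = {lo - 1<..lo - 1 + p}"
    using p unfolding Ieq by auto
  then show "is_partition mu \<and> diagram mu \<subseteq> diagram lam \<and> inj_on (cont N) ?K \<and>
      (\<exists>a. cont N ` ?K = {a<..a + p})"
    using mu inj unfolding I_def by blast
next
  let ?K = "diagram lam - diagram mu"
  let ?E = "{(a, b). a \<in> ?K \<and> b \<in> ?K \<and> cell_adj a b}"
  assume R: "is_partition mu \<and> diagram mu \<subseteq> diagram lam \<and> inj_on (cont N) ?K \<and>
      (\<exists>a. cont N ` ?K = {a<..a + p})"
  then obtain a where mu: "is_partition mu" "diagram mu \<subseteq> diagram lam"
    and inj: "inj_on (cont N) ?K" and a: "cont N ` ?K = {a<..a + p}" by blast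
  have rN: "fst c < N" if "c \<in> ?K" for c
    using that cell_row_less[OF lam] by auto
  have card: "card ?K = p"
    using card_image[OF inj] a by simp
  have sq: "\<not> contains_square ?K"
  proof
    assume "contains_square ?K"
    then obtain i j where "(i, j) \<in> ?K" "(Suc i, Suc j) \<in> ?K"
      unfolding contains_square_def by blast
    then show False using inj_onD[OF inj, of "(i, j)" "(Suc i, Suc j)"] by (auto simp: cont_def)
  qed
  \<comment> \<open>The next content is reached one step to the right or one step up; any larger
    displacement would put a diagonal neighbour of \<open>c\<close> or \<open>d\<close> into the
    skew shape, against injectivity.\<close>
  have adj: "cell_adj c d" if c: "c \<in> ?K" "d \<in> ?K" "cont N d = Suc (cont N c)" for c d
  proof -
    obtain i j i' j' where ij: "c = (i, j)" "d = (i', j')" by (cases c, cases d)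
    have eq: "j' + i = Suc (j + i')"
      using c rN[OF c(1)] rN[OF c(2)] by (auto simp: cont_def ij)
    have "\<not> i < i'"
    proof
      assume "i < i'"
      then have "(Suc i, Suc j) \<in> ?K"
        using skew_convex[OF lam(1) mu(1), of i j i' j' "Suc i" "Suc j"] c eq ij by simp
      then show False
        using inj_onD[OF inj, of "(i, j)" "(Suc i, Suc j)"] c ij by (auto simp: cont_def)
    qed
    moreover have "\<not> Suc i' < i"
    proof
      assume "Suc i' < i"
      then have "(Suc i', Suc j') \<in> ?K"
        using skew_convex[OF lam(1) mu(1), of i' j' i j "Suc i'" "Suc j'"] c eq ij by simp
      then show False
        using inj_onD[OF inj, of "(i', j')" "(Suc i', Suc j')"] c ij by (auto simp: cont_def)
    qed
    ultimately have "i = i' \<or> i = Suc i'" by auto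
    then show ?thesis using eq by (auto simp: cell_adj_def ij)
  qed
  have up: "(c, d) \<in> ?E\<^sup>*" if "c \<in> ?K" "d \<in> ?K" "cont N d = cont N c + k" for c d k
    using that
  proof (induction k arbitrary: d)
    case 0
    then show ?case using inj_onD[OF inj, of c d] by auto
  next
    case (Suc k)
    have "cont N c + k \<in> cont N ` ?K"
      using Suc.prems imageI[of c ?K "cont N"] imageI[of d ?K "cont N"] unfolding a by auto
    then obtain e where e: "e \<in> ?K" "cont N e = cont N c + k" by auto
    then have "(c, e) \<in> ?E\<^sup>*" "(e, d) \<in> ?E"
      using Suc adj[of e d] by auto
    then show ?case by (rule rtrancl_into_rtrancl)
  qed
  have "sym ?E" by (auto simp: sym_def cell_adj_sym)
  then have symE: "(d, c) \<in> ?E\<^sup>*" if "(c, d) \<in> ?E\<^sup>*" for c d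
    using that by (meson sym_rtrancl symD)
  have "cells_connected ?K"
    unfolding cells_connected_def
  proof (intro ballI)
    fix c d assume cd: "c \<in> ?K" "d \<in> ?K"
    show "(c, d) \<in> ?E\<^sup>*"
      using up[OF cd, of "cont N d - cont N c"] symE[OF up[OF cd(2,1), of "cont N c - cont N d"]]
      by (cases "cont N c \<le> cont N d") simp_all
  qed
  then show "removes_rim_hook p lam mu"
    using mu lam card sq by (auto simp: removes_rim_hook_def)
qed

text \<open>Both sides say that the diagonal counts drop by one exactly for \<open>e\<close> in
  \<open>{a<..a + p}\<close>: for the rim hook by its contents, for the beads by
  \<open>count_from_bset\<close> and \<open>count_from_move\<close>.\<close>

lemma removes_rim_hook_iff_slide:
  assumes lam: "is_partition lam" "length lam \<le> N" and p: "0 < p"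
  shows "removes_rim_hook p lam mu \<longleftrightarrow> is_partition mu \<and> length mu \<le> N \<and>
    (\<exists>a. a \<in> gaps p (bset N lam) \<and> bset N mu = slide p a (bset N lam))"
proof -
  let ?K = "diagram lam - diagram mu"
  have diag_K: "diag N e ?K = {c \<in> ?K. cont N c = e}" for e
    using cell_row_less[OF lam] by (fastforce simp: diag_def cont_def)
  have diag_split: "card (diag N e (diagram lam)) = card (diag N e (diagram mu)) + card (diag N e ?K)"
    if "diagram mu \<subseteq> diagram lam" for e
  proof -
    have "diag N e (diagram lam) = diag N e (diagram mu) \<union> diag N e ?K"
      using that by (auto simp: diag_def)
    then show ?thesis
      using card_Un_disjoint[of "diag N e (diagram mu)" "diag N e ?K"] by (auto simp: diag_def)
  qed
  have key: "(diagram mu \<subseteq> diagram lam \<and> inj_on (cont N) ?K \<and> cont N ` ?K = {a<..a + p}) \<longleftrightarrow>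
      a \<in> gaps p (bset N lam) \<and> bset N mu = slide p a (bset N lam)"
    if mu: "is_partition mu" "length mu \<le> N" for a
  proof -
    have "(\<forall>e. count_from (bset N lam) e = count_from (bset N mu) e + (if a < e \<and> e \<le> a + p then 1 else 0)) \<longleftrightarrow>
      (\<forall>e. card (diag N e (diagram lam)) = card (diag N e (diagram mu)) +
         (if a < e \<and> e \<le> a + p then 1 else 0))" (is "_ \<longleftrightarrow> ?D")
      by (simp add: count_from_bset lam mu)
    moreover have "?D \<longleftrightarrow> diagram mu \<subseteq> diagram lam \<and> inj_on (cont N) ?K \<and> cont N ` ?K = {a<..a + p}"
    proof
      assume D: ?D
      have sub: "diagram mu \<subseteq> diagram lam"
        using D by (intro diag_subsetI[OF lam(1) mu(1) _ mu(2)]) simp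
      have K1: "card {c \<in> ?K. cont N c = e} = (if a < e \<and> e \<le> a + p then 1 else 0)" for e
        using D[rule_format, of e] diag_split[OF sub, of e] by (simp add: diag_K)
      have "inj_on (cont N) ?K"
      proof (rule inj_onI)
        fix c d assume cd: "c \<in> ?K" "d \<in> ?K" "cont N c = cont N d"
        have "card {x \<in> ?K. cont N x = cont N c} \<le> Suc 0" unfolding K1 by simp
        moreover have "card {c, d} \<le> card {x \<in> ?K. cont N x = cont N c}"
          using cd by (intro card_mono) auto
        ultimately show "c = d" by (cases "c = d") auto
      qed
      moreover have "e \<in> cont N ` ?K \<longleftrightarrow> e \<in> {a<..a + p}" for e
      proof -
        have "e \<in> cont N ` ?K \<longleftrightarrow> {c \<in> ?K. cont N c = e} \<noteq> {}" by auto
        also have "\<dots> \<longleftrightarrow> card {c \<in> ?K. cont N c = e} \<noteq> 0" by (simp del: Collect_empty_eq)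
        finally show ?thesis unfolding K1 by (simp split: if_splits)
      qed
      ultimately show "diagram mu \<subseteq> diagram lam \<and> inj_on (cont N) ?K \<and> cont N ` ?K = {a<..a + p}"
        using sub by blast
    next
      assume R: "diagram mu \<subseteq> diagram lam \<and> inj_on (cont N) ?K \<and> cont N ` ?K = {a<..a + p}"
      show ?D
      proof
        fix e
        have "card {c \<in> ?K. cont N c = e} = (if a < e \<and> e \<le> a + p then 1 else 0)"
        proof (cases "e \<in> cont N ` ?K")
          case True
          then obtain c where c: "c \<in> ?K" "cont N c = e" by auto
          then have "{c \<in> ?K. cont N c = e} = {c}"
            using R by (auto dest: inj_onD)
          then show ?thesis using True R by simp
        next
          case False
          then have "{c \<in> ?K. cont N c = e} = {}" by auto
          then have "card {c \<in> ?K. cont N c = e} = 0" by (simp only: card.empty)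
          moreover have "\<not> (a < e \<and> e \<le> a + p)" using False R by simp
          ultimately show ?thesis by (simp only: if_False)
        qed
        then show "card (diag N e (diagram lam)) = card (diag N e (diagram mu)) +
            (if a < e \<and> e \<le> a + p then 1 else 0)"
          using diag_split[of e] R by (simp add: diag_K)
      qed
    qed
    ultimately show ?thesis using count_from_move[of "bset N lam" "bset N mu" p a] p by simp
  qed
  have "diagram mu \<subseteq> diagram lam \<Longrightarrow> is_partition mu \<Longrightarrow> length mu \<le> N"
    using length_le_of_subset[OF lam(1)] lam(2) by fastforce
  then show ?thesis
    unfolding removes_rim_hook_contents[OF lam p] using key by blast
qed

section \<open>Covers as rim hooks of length one\<close>

lemma removes_rim_hook_1I:
  assumes "is_partition lam" "is_partition mu" "diagram mu \<subseteq> diagram lam"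
    and K: "diagram lam - diagram mu = {c}"
  shows "removes_rim_hook 1 lam mu"
  unfolding removes_rim_hook_def K using assms(1-3)
  by (auto simp: cells_connected_def contains_square_def)

lemma upper_cover_iff:
  assumes lam: "is_partition lam"
  shows "mu \<in> upper_covers lam \<longleftrightarrow> removes_rim_hook 1 mu lam"
proof
  assume "mu \<in> upper_covers lam"
  then have mu: "is_partition mu" and sub: "diagram lam \<subset> diagram mu"
    and min: "\<And>nu. is_partition nu \<Longrightarrow> diagram lam \<subset> diagram nu \<Longrightarrow> \<not> diagram nu \<subset> diagram mu"
    by (auto simp: upper_covers_def)
  \<comment> \<open>For a cell of the difference with least coordinate sum, all cells to the
    north-west already lie in \<open>lam\<close>, so adding it yields a diagram; as
    \<open>mu\<close> is a minimal extension, that diagram is all of \<open>mu\<close>.\<close>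
  define c where "c = arg_min_on (\<lambda>c. fst c + snd c) (diagram mu - diagram lam)"
  have ne: "diagram mu - diagram lam \<noteq> {}" "finite (diagram mu - diagram lam)" using sub by auto
  have c: "c \<in> diagram mu - diagram lam"
    and cmin: "\<And>d. d \<in> diagram mu - diagram lam \<Longrightarrow> fst c + snd c \<le> fst d + snd d"
    unfolding c_def
    using arg_min_if_finite(1)[OF ne(2,1)] arg_min_least[OF ne(2,1), where f = "\<lambda>c. fst c + snd c"]
    by blast+
  have "\<exists>nu. is_partition nu \<and> diagram nu = insert c (diagram lam)"
  proof (rule partition_of_diagram[of "insert c (diagram lam)"])
    fix i j i' j' assume ij: "(i, j) \<in> insert c (diagram lam)" "i' \<le> i" "j' \<le> j"
    show "(i', j') \<in> insert c (diagram lam)"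
    proof (cases "(i, j) \<in> diagram lam")
      case True
      then show ?thesis using diagram_down[OF lam True] ij by auto
    next
      case False
      then have cij: "c = (i, j)" using ij by auto
      then have "(i', j') \<in> diagram mu" using c diagram_down[OF mu, of i j i' j'] ij by auto
      then show ?thesis using cmin[of "(i', j')"] cij ij by auto
    qed
  qed auto
  then obtain nu where nu: "is_partition nu" "diagram nu = insert c (diagram lam)" by blast
  have "diagram mu = insert c (diagram lam)"
  proof -
    have "diagram lam \<subset> diagram nu" "diagram nu \<subseteq> diagram mu"
      using nu(2) c sub by auto
    then show ?thesis using min[OF nu(1)] nu(2) by (simp add: psubset_eq)
  qed
  then have K: "diagram mu - diagram lam = {c}" using c by auto
  show "removes_rim_hook 1 mu lam"
    using removes_rim_hook_1I[OF mu lam _ K] sub by blast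
next
  assume R: "removes_rim_hook 1 mu lam"
  then obtain c where c: "diagram mu - diagram lam = {c}" "is_partition mu" "diagram lam \<subseteq> diagram mu"
    by (auto simp: removes_rim_hook_def card_1_singleton_iff)
  then show "mu \<in> upper_covers lam"
    unfolding upper_covers_def
  proof (intro CollectI conjI notI)
    assume "\<exists>nu. is_partition nu \<and> diagram lam \<subset> diagram nu \<and> diagram nu \<subset> diagram mu"
    then obtain nu where "diagram lam \<subset> diagram nu" "diagram nu \<subset> diagram mu" by blast
    then obtain x y where "x \<in> diagram nu" "x \<in> diagram mu - diagram lam"
      "y \<notin> diagram nu" "y \<in> diagram mu - diagram lam" by blast
    then show False unfolding c(1) by simp
  qed (use c in auto)
qed

lemma removes_rim_hook_size:
  "removes_rim_hook p lam mu \<Longrightarrow> sum_list lam = sum_list mu + p"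
  using card_Diff_subset[of "diagram mu" "diagram lam"] card_mono[of "diagram lam" "diagram mu"]
  by (auto simp: removes_rim_hook_def card_diagram[symmetric])

subsection \<open>Slides modulo 2\<close>

text \<open>Addition in \<open>bit\<close> must stay addition, since the lemmas on finite sums do
  not match exclusive or.\<close>

declare add_bit_eq_xor [simp del]

definition slide_sum :: "nat \<Rightarrow> (nat set \<Rightarrow> bit) \<Rightarrow> nat set \<Rightarrow> bit" where
  "slide_sum r F S = (\<Sum>a\<in>gaps r S. F (slide r a S))"

lemma finite_gaps [simp]: "finite S \<Longrightarrow> finite (gaps r S)"
  using finite_vimageI[of S "\<lambda>a. a + r"]
  by (auto simp: gaps_def vimage_def inj_def intro: finite_subset[rotated])

lemma finite_slide [simp]: "finite S \<Longrightarrow> finite (slide r a S)"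
  by (simp add: slide_def)

lemma bit_add_self: "x + x = (0::bit)"
  by (cases x) simp_all

text \<open>The terms with \<open>a < b\<close> are matched with those with \<open>b < a\<close>,
  and equal terms cancel in \<open>bit\<close>.\<close>

lemma sum_symmetric_bit:
  fixes G :: "nat \<Rightarrow> nat \<Rightarrow> bit"
  assumes "finite R" "\<And>a b. a \<in> R \<Longrightarrow> b \<in> R \<Longrightarrow> a \<noteq> b \<Longrightarrow> G a b = G b a"
  shows "(\<Sum>(a, b)\<in>{(a, b). a \<in> R \<and> b \<in> R \<and> a \<noteq> b}. G a b) = 0"
proof -
  let ?L = "{(a, b). a \<in> R \<and> b \<in> R \<and> a < b}" and ?U = "{(a, b). a \<in> R \<and> b \<in> R \<and> b < a}"
  have fin: "finite ?L" "finite ?U"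
    by (rule finite_subset[of _ "R \<times> R"]; use assms(1) in auto)+
  have "{(a, b). a \<in> R \<and> b \<in> R \<and> a \<noteq> b} = ?L \<union> ?U" by auto
  then have "(\<Sum>(a, b)\<in>{(a, b). a \<in> R \<and> b \<in> R \<and> a \<noteq> b}. G a b) =
      (\<Sum>(a, b)\<in>?L. G a b) + (\<Sum>(a, b)\<in>?U. G a b)"
    using fin by (simp add: sum.union_disjoint disjoint_iff)
  also have "(\<Sum>(a, b)\<in>?U. G a b) = (\<Sum>(a, b)\<in>?L. G a b)"
    by (rule sum.reindex_bij_witness[of _ prod.swap prod.swap]) (use assms(2) in auto)
  finally show ?thesis by (simp add: bit_add_self)
qed

text \<open>Two successive moves of different beads cancel against the same moves in the other order,
  unless only one order is legal; what survives amounts to moving one bead twice as far.\<close>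

lemma slide_sum_slide_sum:
  assumes fin: "finite S" and r: "0 < r"
  shows "slide_sum r (slide_sum r F) S = slide_sum (2 * r) F S"
proof -
  let ?P = "SIGMA a:gaps r S. gaps r (slide r a S)"
  let ?G = "\<lambda>(a, b). F (slide r b (slide r a S))"
  \<comment> \<open>The surviving pair for a bead at \<open>c + 2 * r\<close>: if
    \<open>c + r\<close> is occupied, that bead drops first and the upper one takes its place;
    otherwise the upper bead passes through \<open>c + r\<close>. Beads are indistinguishable, so
    both amount to one slide by \<open>2 * r\<close> into \<open>c\<close>.\<close>
  let ?h = "\<lambda>c. if c + r \<in> S then (c, c + r) else (c + r, c)"
  let ?A = "?h ` gaps (2 * r) S"
  let ?B = "{(a, b). a \<in> gaps r S \<and> b \<in> gaps r S \<and> a \<noteq> b}"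
  have "slide_sum r (slide_sum r F) S = sum ?G ?P"
    by (simp add: slide_sum_def sum.Sigma fin)
  also have "?P = ?A \<union> ?B"
  proof (intro set_eqI iffI)
    fix x assume "x \<in> ?P"
    then obtain a b where x: "x = (a, b)" "a \<notin> S" "a + r \<in> S" "b \<in> gaps r (slide r a S)"
      by (auto simp: gaps_def)
    then have "b \<noteq> a" "b \<notin> S \<or> b = a + r" "b + r = a \<or> b + r \<in> S"
      by (auto simp: gaps_def slide_def)
    \<comment> \<open>The second slide fills the position just vacated, or continues with the bead
      just moved, or concerns an independent bead.\<close>
    then consider "b = a + r" "a + r + r \<in> S" | "a = b + r" "b \<notin> S" | "b \<in> gaps r S" "b \<noteq> a"
      unfolding gaps_def using r by (metis (mono_tags, lifting) add_lessD1 less_add_same_cancel1 less_irrefl mem_Collect_eq)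
    then show "x \<in> ?A \<union> ?B"
    proof cases
      case 1
      then have "a \<in> gaps (2 * r) S" "x = ?h a" using x by (auto simp: gaps_def mult_2 add.assoc)
      then show ?thesis by blast
    next
      case 2
      then have "b \<in> gaps (2 * r) S" "x = ?h b" using x by (auto simp: gaps_def mult_2 add.assoc)
      then show ?thesis by blast
    next
      case 3
      then show ?thesis using x by (auto simp: gaps_def)
    qed
  next
    fix x assume "x \<in> ?A \<union> ?B"
    then show "x \<in> ?P"
      using r by (auto simp: gaps_def slide_def mult_2 add.assoc)
  qed
  also have "sum ?G (?A \<union> ?B) = sum ?G ?A + sum ?G ?B"
  proof (rule sum.union_disjoint)
    show "finite ?A" using fin by simp
    show "finite ?B"
      by (rule finite_subset[of _ "gaps r S \<times> gaps r S"]) (use fin in auto)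
    show "?A \<inter> ?B = {}" by (auto simp: gaps_def)
  qed
  also have "sum ?G ?B = 0"
  proof (rule sum_symmetric_bit)
    fix a b assume "a \<in> gaps r S" "b \<in> gaps r S" "a \<noteq> b"
    then have "slide r b (slide r a S) = slide r a (slide r b S)"
      by (auto simp: gaps_def slide_def)
    then show "F (slide r b (slide r a S)) = F (slide r a (slide r b S))" by simp
  qed (use fin in simp)
  also have "sum ?G ?A = slide_sum (2 * r) F S"
  proof -
    have inj: "inj_on ?h (gaps (2 * r) S)"
      using r by (auto simp: inj_on_def split: if_splits)
    have eq: "?G (?h c) = F (slide (2 * r) c S)" if "c \<in> gaps (2 * r) S" for c
    proof -
      have "(case ?h c of (a, b) \<Rightarrow> slide r b (slide r a S)) = slide (2 * r) c S"
        using that r by (auto simp: gaps_def slide_def mult_2 add.assoc)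
      then show ?thesis by (auto split: if_splits)
    qed
    show ?thesis unfolding sum.reindex[OF inj] slide_sum_def o_def using eq by (intro sum.cong refl) auto
  qed
  finally show ?thesis by simp
qed

lemma slide_sum_cong:
  assumes "finite S" "\<And>T. finite T \<Longrightarrow> F T = G T"
  shows "slide_sum r F S = slide_sum r G S"
  unfolding slide_sum_def using assms by (intro sum.cong) auto

text \<open>Repeated squaring: doubling the number of slides doubles their length.\<close>

lemma slide_sum_iter:
  "finite S \<Longrightarrow> (slide_sum 1 ^^ 2 ^ k) F S = slide_sum (2 ^ k) F S"
proof (induction k arbitrary: S F)
  case (Suc k)
  have "(slide_sum 1 ^^ 2 ^ Suc k) F S = (slide_sum 1 ^^ 2 ^ k) ((slide_sum 1 ^^ 2 ^ k) F) S"
    by (simp add: mult_2 funpow_add)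
  also have "\<dots> = slide_sum (2 ^ k) ((slide_sum 1 ^^ 2 ^ k) F) S"
    by (rule Suc)+
  also have "\<dots> = slide_sum (2 ^ k) (slide_sum (2 ^ k) F) S"
    using Suc by (intro slide_sum_cong) auto
  also have "\<dots> = slide_sum (2 ^ Suc k) F S"
    using slide_sum_slide_sum[OF Suc.prems, of "2 ^ k"] by simp
  finally show ?case .
qed simp

section \<open>Parity of the number of tableaux on beta-sets\<close>

text \<open>Since \<open>{..<N}\<close> is the beta-set of the empty partition, the excess of the
  bead sum over it is the size of the encoded partition.\<close>

definition beads :: "nat \<Rightarrow> nat \<Rightarrow> nat set \<Rightarrow> bool" where
  "beads N n S \<longleftrightarrow> finite S \<and> card S = N \<and> \<Sum>S = n + \<Sum>{..<N}"

text \<open>By \<open>num_syt_paths\<close> below, this is the number of standard tableaux modulo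
  2.\<close>

definition paths :: "nat \<Rightarrow> nat \<Rightarrow> nat set \<Rightarrow> bit" where
  "paths N n = (slide_sum 1 ^^ n) (\<lambda>S. if S = {..<N} then 1 else 0)"

definition oddset :: "nat \<Rightarrow> nat \<Rightarrow> nat set \<Rightarrow> bool" where
  "oddset N n S \<longleftrightarrow> beads N n S \<and> paths N n S = 1"

lemma beads_bset:
  "is_partition lam \<Longrightarrow> length lam \<le> N \<Longrightarrow> beads N (sum_list lam) (bset N lam)"
  by (simp add: beads_def card_bset sum_bset)

lemma beads_partition:
  assumes "beads N n S"
  obtains lam where "is_partition lam" "length lam \<le> N" "bset N lam = S" "sum_list lam = n"
proof -
  obtain lam where "is_partition lam" "length lam \<le> N" "bset N lam = S"
    using partition_of_bset assms unfolding beads_def by metis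
  then show ?thesis using that[of lam] assms sum_bset[of lam N] by (simp add: beads_def)
qed

lemma beads_slide:
  assumes "beads N n S" "a \<in> gaps r S"
  obtains m where "n = m + r" "beads N m (slide r a S)"
proof -
  have S: "finite S" "card S = N" "\<Sum>S = n + \<Sum>{..<N}" and a: "a \<notin> S" "a + r \<in> S"
    using assms by (auto simp: beads_def gaps_def)
  have fin: "finite (slide r a S)" using S by simp
  have card: "card (slide r a S) = N"
  proof -
    have "card (slide r a S) = Suc (card (S - {a + r}))"
      unfolding slide_def using S a by (intro card_insert_disjoint) auto
    then show ?thesis using card.remove[OF S(1) a(2)] S(2) by metis
  qed
  have "\<Sum>(slide r a S) + r = \<Sum>S"
    using S a sum.remove[OF S(1) a(2), of "\<lambda>x. x"] by (simp add: slide_def)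
  moreover obtain lam where "is_partition lam" "length lam \<le> N" "bset N lam = slide r a S"
    using partition_of_bset[OF fin card] by metis
  then have "\<Sum>(slide r a S) = sum_list lam + \<Sum>{..<N}" using sum_bset by metis
  ultimately have "n = sum_list lam + r \<and> beads N (sum_list lam) (slide r a S)"
    using S fin card by (simp add: beads_def)
  then show ?thesis using that by blast
qed

lemma gaps_empty:
  assumes "beads N m S" "m < r"
  shows "gaps r S = {}"
proof (rule equals0I)
  fix a assume "a \<in> gaps r S"
  with assms(1) obtain m' where "m = m' + r" by (rule beads_slide)
  then show False using assms(2) by simp
qed

text \<open>A partition of \<open>m\<close> has at most \<open>m\<close> rows, so the positions
  below \<open>N - m\<close> all hold beads of empty rows.\<close>

lemma beads_lower:
  assumes "beads N m S" "x \<notin> S"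
  shows "N \<le> x + m"
proof (rule ccontr)
  assume *: "\<not> N \<le> x + m"
  obtain lam where lam: "is_partition lam" "bset N lam = S" "sum_list lam = m"
    using beads_partition[OF assms(1)] by metis
  have "row lam (N - Suc x) = 0"
    using * lam length_le_sum_list[OF lam(1)] by (simp add: row_def)
  then have "x \<in> bset N lam"
    using * by (auto simp: bset_def intro!: image_eqI[of _ _ "N - Suc x"])
  then show False using lam assms by simp
qed

lemma beads_0: "beads N 0 S \<longleftrightarrow> S = {..<N}"
proof
  assume "beads N 0 S"
  then show "S = {..<N}"
    by (rule beads_partition) (metis bset_Nil sum_list_eq_0_partition)
qed (auto simp: beads_def)

text \<open>Two different slides by \<open>r\<close> could be carried out one after the other, which
  would remove \<open>2 * r\<close> cells.\<close>

lemma gaps_unique: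
  assumes "beads N n S" "n < 2 * r" "a \<in> gaps r S" "b \<in> gaps r S"
  shows "a = b"
proof (rule ccontr)
  assume "a \<noteq> b"
  obtain m where m: "n = m + r" "beads N m (slide r a S)"
    using beads_slide[OF assms(1,3)] .
  have "b \<in> gaps r (slide r a S)"
    using \<open>a \<noteq> b\<close> assms by (auto simp: gaps_def slide_def)
  then show False using gaps_empty[OF m(2), of r] m(1) assms(2) by simp
qed

text \<open>The first \<open>2 ^ k\<close> unit slides are merged into one long slide by
  \<open>slide_sum_iter\<close>.\<close>

lemma paths_reduce:
  assumes "beads N n S" "n = 2 ^ k + m"
  shows "paths N n S = (\<Sum>a\<in>gaps (2 ^ k) S. paths N m (slide (2 ^ k) a S))"
proof -
  have "paths N n S = (slide_sum 1 ^^ 2 ^ k) (paths N m) S"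
    by (simp add: paths_def assms(2) funpow_add)
  also have "\<dots> = slide_sum (2 ^ k) (paths N m) S"
    using assms(1) by (intro slide_sum_iter) (simp add: beads_def)
  finally show ?thesis by (simp add: slide_sum_def)
qed

lemma oddset_reduce:
  assumes "oddset N n S" "n = 2 ^ k + m" "m < 2 ^ k"
  obtains a where "gaps (2 ^ k) S = {a}" "oddset N m (slide (2 ^ k) a S)"
proof -
  have S: "beads N n S" "paths N n S = 1" using assms by (auto simp: oddset_def)
  have "gaps (2 ^ k) S \<noteq> {}"
    using paths_reduce[OF S(1) assms(2)] S(2) by auto
  then obtain a where a: "a \<in> gaps (2 ^ k) S" by auto
  then have eq: "gaps (2 ^ k) S = {a}"
    using gaps_unique[OF S(1), of "2 ^ k"] assms by auto
  then have "paths N m (slide (2 ^ k) a S) = 1"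
    using paths_reduce[OF S(1) assms(2)] S(2) by simp
  moreover obtain m' where "n = m' + 2 ^ k" "beads N m' (slide (2 ^ k) a S)"
    using beads_slide[OF S(1) a] .
  ultimately show ?thesis using that[OF eq] assms by (simp add: oddset_def)
qed

lemma oddset_lift:
  assumes "beads N n S" "n = 2 ^ k + m" "m < 2 ^ k"
    and "a \<in> gaps (2 ^ k) S" "oddset N m (slide (2 ^ k) a S)"
  shows "oddset N n S" "gaps (2 ^ k) S = {a}"
proof -
  show eq: "gaps (2 ^ k) S = {a}"
    using gaps_unique[OF assms(1), of "2 ^ k"] assms by auto
  show "oddset N n S"
    using paths_reduce[OF assms(1,2)] assms eq by (simp add: oddset_def)
qed

section \<open>Covers compared before and after removing a long hook\<close>

definition unit_cover :: "nat set \<Rightarrow> nat set \<Rightarrow> bool" where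
  "unit_cover S T \<longleftrightarrow> (\<exists>d. d \<in> gaps 1 T \<and> S = slide 1 d T)"

lemma unit_cover_iff: "unit_cover S T \<longleftrightarrow> (\<exists>d. d \<in> S \<and> Suc d \<notin> S \<and> T = insert (Suc d) (S - {d}))"
proof
  assume "unit_cover S T"
  then obtain d where "d \<in> gaps 1 T" "S = slide 1 d T" by (auto simp: unit_cover_def)
  then have "d \<in> S \<and> Suc d \<notin> S \<and> T = insert (Suc d) (S - {d})"
    by (auto simp: gaps_def slide_def)
  then show "\<exists>d. d \<in> S \<and> Suc d \<notin> S \<and> T = insert (Suc d) (S - {d})" by blast
next
  assume "\<exists>d. d \<in> S \<and> Suc d \<notin> S \<and> T = insert (Suc d) (S - {d})"
  then obtain d where "d \<in> S \<and> Suc d \<notin> S \<and> T = insert (Suc d) (S - {d})" by blast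
  then have "d \<in> gaps 1 T \<and> S = slide 1 d T"
    by (auto simp: gaps_def slide_def)
  then show "unit_cover S T" unfolding unit_cover_def by blast
qed

lemma beads_unit_cover:
  assumes "beads N n S" "unit_cover S T"
  shows "beads N (Suc n) T"
proof -
  obtain d where d: "d \<in> S" "Suc d \<notin> S" "T = insert (Suc d) (S - {d})"
    using assms(2) by (auto simp: unit_cover_iff)
  have S: "finite S" "card S = N" "\<Sum>S = n + \<Sum>{..<N}" using assms(1) by (auto simp: beads_def)
  have "card T = card S"
  proof -
    have "card T = Suc (card (S - {d}))"
      unfolding d(3) using S d by (intro card_insert_disjoint) auto
    then show ?thesis using card.remove[OF S(1) d(1)] by metis
  qed
  moreover have "\<Sum>T = Suc (\<Sum>S)"
    using sum.remove[OF S(1) d(1), of "\<lambda>x. x"] S d by simp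
  ultimately show ?thesis using S d by (simp add: beads_def)
qed

text \<open>Let \<open>S\<close> and \<open>T\<close> have a single bead displaced by \<open>r\<close>, above the gaps \<open>x\<close> and \<open>y\<close>, and suppose
  that the core of \<open>T\<close> arises from that of \<open>S\<close> by pushing the bead \<open>c\<close> to the next runner of the
  \<open>r\<close>-abacus. Then \<open>T\<close> covers \<open>S\<close> iff \<open>y\<close> is the image of \<open>x\<close> under the exchange of these two runners.\<close>

definition swapped :: "nat \<Rightarrow> nat \<Rightarrow> nat \<Rightarrow> nat \<Rightarrow> bool" where
  "swapped r c x y \<longleftrightarrow> (if x = c then y = Suc c else if x + r = Suc c then y + r = c else y = x)"

text \<open>If the displaced bead itself is pushed (\<open>d = x + r\<close>), the step shows in the
  core at \<open>x\<close>. If a bead enters the gap (\<open>Suc d = x\<close>), the gap moves to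
  \<open>d\<close> and the step shows one period higher, at \<open>d + r\<close>. Otherwise step and
  gap stay where they are.\<close>

lemma core_step:
  assumes r: "2 \<le> r" and x: "gaps r S = {x}" and flush: "gaps r (slide r x S) = {}"
    and ST: "unit_cover S T" and y: "gaps r T = {y}"
  obtains c where "c \<in> slide r x S" "Suc c \<notin> slide r x S"
    "slide r y T = insert (Suc c) (slide r x S - {c})" "swapped r c x y"
proof -
  define A where "A = slide r x S"
  obtain d where d: "d \<in> S" "Suc d \<notin> S" "T = insert (Suc d) (S - {d})"
    using ST by (auto simp: unit_cover_iff)
  have xS: "x \<notin> S" "x + r \<in> S" using x by (auto simp: gaps_def)
  have yT: "y \<notin> T" "y + r \<in> T" using y by (auto simp: gaps_def)
  have A: "z \<in> A \<longleftrightarrow> z = x \<or> z \<in> S \<and> z \<noteq> x + r" for z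
    by (auto simp: A_def slide_def)
  have T: "z \<in> T \<longleftrightarrow> z = Suc d \<or> z \<in> S \<and> z \<noteq> d" for z
    using d by auto
  have fl: "z \<in> A" if "z + r \<in> A" for z
    using flush that by (auto simp: gaps_def A_def)
  note main = that
  have res: thesis if "c \<in> A" "Suc c \<notin> A" "swapped r c x y"
    "\<And>z. z = y \<or> z \<in> T \<and> z \<noteq> y + r \<longleftrightarrow> z = Suc c \<or> z \<in> A \<and> z \<noteq> c" for c
  proof (rule main)
    show "slide r y T = insert (Suc c) (slide r x S - {c})"
      using that(4) unfolding A_def[symmetric] by (auto simp: slide_def)
  qed (use that in \<open>auto simp: A_def\<close>)
  consider (1) "d = x + r" | (2) "Suc d = x" | (3) "d \<noteq> x + r" "Suc d \<noteq> x" by blast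
  then show thesis
  proof cases
    case 1
    have yx: "y = Suc x"
    proof (rule ccontr)
      assume "y \<noteq> Suc x"
      then have "y + r \<in> A" "y \<noteq> x" using yT T A 1 d xS by auto
      from this(1) have "y \<in> A" by (rule fl)
      then have "y = d" using \<open>y \<noteq> x\<close> yT T A by auto
      then have "x + r \<in> A" using fl[of "x + r"] \<open>y + r \<in> A\<close> 1 by simp
      then show False using A r by simp
    qed
    show ?thesis
    proof (rule res[of x])
      show "Suc x \<notin> A" using yT T A 1 yx r by auto
    qed (use r xS 1 yx yT d in \<open>auto simp: A T swapped_def\<close>)
  next
    case 2
    have yx: "y = d"
    proof (rule ccontr)
      assume "y \<noteq> d"
      show False
      proof (cases "y + r = x + r")
        case True
        then show False using yT T 2 by auto
      next
        case False
        then have "y + r \<in> A" using yT T A 2 by auto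
        then have "y \<in> A" by (rule fl)
        then show False using yT T A 2 \<open>y \<noteq> d\<close> False by auto
      qed
    qed
    show ?thesis
    proof (rule res[of "d + r"])
      show "swapped r (d + r) x y"
        using 2 yx r by (auto simp: swapped_def)
    qed (use r xS 2 yx yT d in \<open>auto simp: A T\<close>)
  next
    case 3
    have "x \<in> gaps r T"
      using 3 xS T by (auto simp: gaps_def)
    then have yx: "y = x" using y by auto
    show ?thesis
    proof (rule res[of d])
      show "swapped r d x y" using yx d xS by (auto simp: swapped_def)
    qed (use r xS 3 yx yT d in \<open>auto simp: A T\<close>)
  qed
qed

text \<open>Inverts the three cases of \<open>core_step\<close>: a step at \<open>x\<close> lifts to
  the displaced bead at \<open>x + r\<close>, a step into \<open>x + r\<close> lifts to a step into
  the gap \<open>x\<close>, and any other step lifts to itself.\<close>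

lemma core_lift:
  assumes r: "2 \<le> r" and x: "x \<in> gaps r S" and flush: "gaps r (slide r x S) = {}"
    and c: "c \<in> slide r x S" "Suc c \<notin> slide r x S" "r \<le> c"
  obtains T y where "unit_cover S T" "y \<in> gaps r T" "slide r y T = insert (Suc c) (slide r x S - {c})"
proof -
  define A where "A = slide r x S"
  have xS: "x \<notin> S" "x + r \<in> S" using x by (auto simp: gaps_def)
  have A: "z \<in> A \<longleftrightarrow> z = x \<or> z \<in> S \<and> z \<noteq> x + r" for z
    by (auto simp: A_def slide_def)
  have fl: "z \<in> A" if "z + r \<in> A" for z
    using flush that by (auto simp: gaps_def A_def)
  have cA: "c \<in> A" "Suc c \<notin> A" using c by (auto simp: A_def)
  note main = that
  have res: thesis if "d \<in> S" "Suc d \<notin> S" "y \<notin> insert (Suc d) (S - {d})"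
    "y + r \<in> insert (Suc d) (S - {d})"
    "\<And>z. z = y \<or> z \<in> insert (Suc d) (S - {d}) \<and> z \<noteq> y + r \<longleftrightarrow> z = Suc c \<or> z \<in> A \<and> z \<noteq> c" for d y
  proof (rule main)
    show "unit_cover S (insert (Suc d) (S - {d}))" unfolding unit_cover_iff using that(1,2) by blast
    show "y \<in> gaps r (insert (Suc d) (S - {d}))" using that by (simp add: gaps_def)
    show "slide r y (insert (Suc d) (S - {d})) = insert (Suc c) (slide r x S - {c})"
    proof (rule set_eqI)
      show "z \<in> slide r y (insert (Suc d) (S - {d})) \<longleftrightarrow> z \<in> insert (Suc c) (slide r x S - {c})" for z
        using that(5)[of z] unfolding A_def[symmetric] slide_def[of r y]
        by (simp only: insert_iff Diff_iff empty_iff simp_thms)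
    qed
  qed
  consider (1) "x = c" | (2) "x + r = Suc c" | (3) "x \<noteq> c" "x + r \<noteq> Suc c" by blast
  then show thesis
  proof cases
    case 1
    have "Suc c + r \<notin> A" using fl[of "Suc c"] cA by blast
    then show ?thesis
      using 1 cA xS r by (intro res[of "x + r" "Suc x"]) (auto simp: A)
  next
    case 2
    \<comment> \<open>Here \<open>r \<le> c\<close> is essential: it gives \<open>0 < x\<close>, so
      there is a position \<open>x'\<close> for the bead that moves into the gap.\<close>
    then obtain x' where x': "x = Suc x'" using c r by (cases x) auto
    have "x' \<in> A" using fl[of x'] cA 2 x' by simp
    then show ?thesis
      using 2 cA xS r x' by (intro res[of x' x']) (auto simp: A)
  next
    case 3
    then show ?thesis
      using cA xS r by (intro res[of c x]) (auto simp: A)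
  qed
qed

subsection \<open>Reduction to the core\<close>

lemma slide_inv: "0 < r \<Longrightarrow> a \<in> gaps r S \<Longrightarrow> S = insert (a + r) (slide r a S - {a})"
  by (auto simp: gaps_def slide_def)

definition odd_up :: "nat \<Rightarrow> nat \<Rightarrow> nat set \<Rightarrow> nat set set" where
  "odd_up N n S = {T. oddset N (Suc n) T \<and> unit_cover S T}"

lemma unit_cover_bead_unique:
  assumes "insert (Suc c) (A - {c}) = insert (Suc d) (A - {d})"
    and "c \<in> A" "Suc c \<notin> A" "d \<in> A" "Suc d \<notin> A"
  shows "c = (d :: nat)"
  using assms by (metis Diff_iff insert_iff n_not_Suc_n singleton_iff)

lemma swapped_unique: "swapped r c x y \<Longrightarrow> swapped r c x y' \<Longrightarrow> y = y'"
  by (auto simp: swapped_def split: if_splits)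

text \<open>A collision would pair \<open>c\<close> with \<open>Suc c\<close>, or the positions
  \<open>r\<close> below these two. The first needs \<open>Suc c\<close> in \<open>A\<close>, the
  second needs \<open>c\<close> outside \<open>A\<close>.\<close>

lemma swapped_inj:
  assumes "swapped r c x y" "swapped r c x' y" "0 < r"
    and "x \<in> A" "x + r \<notin> A" "x' \<in> A" "x' + r \<notin> A" "c \<in> A" "Suc c \<notin> A"
  shows "x = x'"
  using assms by (auto simp: swapped_def split: if_splits)

text \<open>As \<open>Suc m < 2 ^ k\<close>, both \<open>n\<close> and \<open>Suc n\<close> have
  leading binary digit \<open>2 ^ k\<close>, so \<open>S\<close> and its odd covers each lose one
  hook of the same length; taking cores is then a bijection.\<close>

lemma card_odd_up_reduce:
  assumes S: "oddset N n S" and n: "n = 2 ^ k + m" and m: "Suc m < 2 ^ k" and N: "2 * 2 ^ k \<le> N"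
  obtains x where "gaps (2 ^ k) S = {x}" "oddset N m (slide (2 ^ k) x S)"
    "card (odd_up N n S) = card (odd_up N m (slide (2 ^ k) x S))"
proof -
  define r :: nat where "r = 2 ^ k"
  have r: "2 \<le> r" "0 < r" and nr: "n = r + m" "Suc n = r + Suc m" "Suc m < r" "m < r" "2 * r \<le> N"
    using m n N by (auto simp: r_def)
  obtain x where x: "gaps r S = {x}" and A: "oddset N m (slide r x S)"
    using oddset_reduce[OF S n] nr unfolding r_def by blast
  define A where "A = slide r x S"
  note A = A[folded A_def]
  have flush: "gaps r A = {}"
    using A nr gaps_empty[of N m A r] by (simp add: oddset_def)
  define core where "core T = slide r (the_elem (gaps r T)) T" for T
  have up: "\<exists>y c. gaps r T = {y} \<and> oddset N (Suc m) (slide r y T) \<and> c \<in> A \<and> Suc c \<notin> A \<and>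
     slide r y T = insert (Suc c) (A - {c}) \<and> swapped r c x y" if T: "T \<in> odd_up N n S" for T
  proof -
    have "oddset N (Suc n) T" "unit_cover S T" using T by (auto simp: odd_up_def)
    then obtain y where y: "gaps r T = {y}" "oddset N (Suc m) (slide r y T)"
      using oddset_reduce[of N "Suc n" T k "Suc m"] nr unfolding r_def by metis
    obtain c where "c \<in> A" "Suc c \<notin> A" "slide r y T = insert (Suc c) (A - {c})" "swapped r c x y"
      using core_step[OF r(1) x flush[unfolded A_def] \<open>unit_cover S T\<close> y(1)] unfolding A_def by blast
    with y show ?thesis by blast
  qed
  have "bij_betw core (odd_up N n S) (odd_up N m A)"
  proof (rule bij_betw_imageI[OF inj_onI])
    fix T T' assume TT': "T \<in> odd_up N n S" "T' \<in> odd_up N n S" "core T = core T'"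
    obtain y c where y: "gaps r T = {y}" "c \<in> A" "Suc c \<notin> A"
      "slide r y T = insert (Suc c) (A - {c})" "swapped r c x y"
      using up[OF TT'(1)] by blast
    obtain y' c' where y': "gaps r T' = {y'}" "c' \<in> A" "Suc c' \<notin> A"
      "slide r y' T' = insert (Suc c') (A - {c'})" "swapped r c' x y'"
      using up[OF TT'(2)] by blast
    have eq: "slide r y T = slide r y' T'" using TT'(3) y y' by (simp add: core_def)
    then have "c = c'" using y y' by (intro unit_cover_bead_unique[of c A c']) simp_all
    \<comment> \<open>\<open>S\<close> fixes \<open>x\<close>, the core fixes \<open>c\<close>, and
      together they fix the gap, from which \<open>slide_inv\<close> rebuilds the whole set.\<close>
    then have "y = y'" using y y' by (auto intro: swapped_unique)
    then show "T = T'"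
      using slide_inv[OF r(2), of y T] slide_inv[OF r(2), of y' T'] y(1) y'(1) eq by auto
  next
    show "core ` odd_up N n S = odd_up N m A"
    proof (intro set_eqI iffI)
      fix B assume "B \<in> core ` odd_up N n S"
      then obtain T where T: "T \<in> odd_up N n S" "B = core T" by auto
      obtain y c where y: "gaps r T = {y}" "oddset N (Suc m) (slide r y T)" "c \<in> A" "Suc c \<notin> A"
        "slide r y T = insert (Suc c) (A - {c})"
        using up[OF T(1)] by blast
      then have "unit_cover A B" using T by (auto simp: unit_cover_iff core_def)
      then show "B \<in> odd_up N m A" using y T by (simp add: odd_up_def core_def)
    next
      fix B assume "B \<in> odd_up N m A"
      then have B: "oddset N (Suc m) B" "unit_cover A B" by (auto simp: odd_up_def)
      then obtain c where c: "c \<in> A" "Suc c \<notin> A" "B = insert (Suc c) (A - {c})"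
        by (auto simp: unit_cover_iff)
      \<comment> \<open>The empty position \<open>Suc c\<close> cannot lie low; with
        \<open>2 * r \<le> N\<close> this yields \<open>r \<le> c\<close>, the room that
        \<open>core_lift\<close> requires.\<close>
      have "N \<le> Suc c + m" using beads_lower[of N m A "Suc c"] A c by (simp add: oddset_def)
      then have "r \<le> c" using nr by simp
      then obtain T y where T: "unit_cover S T" "y \<in> gaps r T" "slide r y T = B"
        using core_lift[OF r(1), of x S c] x flush c unfolding A_def by auto
      have bT: "beads N (Suc n) T" using beads_unit_cover[OF _ T(1)] S by (simp add: oddset_def)
      have "oddset N (Suc n) T" "gaps r T = {y}"
        using oddset_lift[OF bT, of k "Suc m" y] nr T B unfolding r_def by auto
      then have "T \<in> odd_up N n S" "core T = B" using T by (auto simp: odd_up_def core_def)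
      then show "B \<in> core ` odd_up N n S" by blast
    qed
  qed
  then have "card (odd_up N n S) = card (odd_up N m A)" by (rule bij_betw_same_card)
  then show ?thesis using that x A unfolding A_def r_def by blast
qed

section \<open>Confluence of slides\<close>

definition slides_to :: "nat \<Rightarrow> nat set \<Rightarrow> nat set \<Rightarrow> bool" where
  "slides_to r S T \<longleftrightarrow> (\<exists>a. a \<in> gaps r S \<and> T = slide r a S)"

text \<open>Slides into different positions move different beads, and neither blocks the
  other.\<close>

lemma slides_to_diamond:
  assumes "slides_to r S T" "slides_to r S T'" "T \<noteq> T'"
  obtains U where "slides_to r T U" "slides_to r T' U"
proof -
  obtain a b where a: "a \<in> gaps r S" "T = slide r a S" and b: "b \<in> gaps r S" "T' = slide r b S"
    using assms by (auto simp: slides_to_def)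
  have "a \<noteq> b" using assms(3) a b by auto
  then have "b \<in> gaps r T" "a \<in> gaps r T'" "slide r b T = slide r a T'"
    using a b by (auto simp: gaps_def slide_def)
  then show ?thesis using that unfolding slides_to_def by metis
qed

text \<open>The diamond is pushed along the path to \<open>K\<close>; since nothing can move in
  \<open>K\<close>, the other branch ends there as well.\<close>

lemma slides_to_normal_step:
  assumes "(slides_to r)\<^sup>*\<^sup>* S K" "gaps r K = {}" "slides_to r S T"
  shows "(slides_to r)\<^sup>*\<^sup>* T K"
  using assms(1,3)
proof (induction arbitrary: T rule: converse_rtranclp_induct)
  case base
  then show ?case using assms(2) by (auto simp: slides_to_def)
next
  case (step S S1)
  show ?case
  proof (cases "T = S1")
    case False
    then obtain U where "slides_to r T U" "slides_to r S1 U"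
      using slides_to_diamond step by metis
    then show ?thesis using step.IH by (metis converse_rtranclp_into_rtranclp)
  qed (use step in simp)
qed

lemma slides_to_normal_unique:
  assumes "(slides_to r)\<^sup>*\<^sup>* S K" "gaps r K = {}" "(slides_to r)\<^sup>*\<^sup>* S K'" "gaps r K' = {}"
  shows "K' = K"
proof -
  have "(slides_to r)\<^sup>*\<^sup>* K' K"
    using assms(3,1) by (induction rule: rtranclp_induct) (blast intro: slides_to_normal_step[OF _ assms(2)])+
  then show ?thesis
    using assms(4) by (cases rule: converse_rtranclpE) (auto simp: slides_to_def)
qed

text \<open>A long slide may jump over beads, and short slides may not. If the position
  \<open>e\<close> just below the top bead is occupied, the bead there makes the rest of the journey
  first and the top bead replaces it; otherwise the top bead moves to \<open>e\<close> and goes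
  on.\<close>

lemma slides_to_multiple:
  assumes "0 < q" "a \<in> gaps (Suc s * q) S"
  shows "(slides_to q)\<^sup>*\<^sup>* S (slide (Suc s * q) a S)"
  using assms(2)
proof (induction s arbitrary: S)
  case 0
  then have "slides_to q S (slide q a S)" by (auto simp: slides_to_def)
  then show ?case by simp
next
  case (Suc s)
  define e where "e = a + Suc s * q"
  have e: "a + Suc (Suc s) * q = e + q" "a < e" using assms(1) by (auto simp: e_def)
  have a: "a \<notin> S" "e + q \<in> S" using Suc.prems unfolding gaps_def e(1)[symmetric] by blast+
  have slide1: "slide (Suc s * q) a X = insert a (X - {e})" for X
    by (simp only: slide_def e_def)
  have slide2: "slide (Suc (Suc s) * q) a X = insert a (X - {e + q})" for X
    by (simp only: slide_def e)
  have gaps1: "a \<in> gaps (Suc s * q) X \<longleftrightarrow> a \<notin> X \<and> e \<in> X" for X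
    by (simp only: gaps_def e_def mem_Collect_eq)
  show ?case
  proof (cases "e \<in> S")
    case True
    then have "(slides_to q)\<^sup>*\<^sup>* S (insert a (S - {e}))"
      using a Suc.IH[of S] unfolding gaps1 slide1 by blast
    moreover have "e \<in> gaps q (insert a (S - {e}))"
      using a e(2) assms(1) by (auto simp: gaps_def)
    moreover have "slide q e (insert a (S - {e})) = insert a (S - {e + q})"
      using True e(2) assms(1) by (auto simp: slide_def)
    ultimately show ?thesis
      unfolding slide2 by (metis slides_to_def rtranclp.rtrancl_into_rtrancl)
  next
    case False
    then have "slides_to q S (slide q e S)" using a by (auto simp: slides_to_def gaps_def)
    moreover have "a \<notin> slide q e S" "e \<in> slide q e S" using a e(2) by (auto simp: slide_def)
    then have "(slides_to q)\<^sup>*\<^sup>* (slide q e S) (insert a (slide q e S - {e}))"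
      using Suc.IH[of "slide q e S"] unfolding gaps1 slide1 by blast
    moreover have "insert a (slide q e S - {e}) = insert a (S - {e + q})"
      using False by (auto simp: slide_def)
    ultimately show ?thesis unfolding slide2 by (metis converse_rtranclp_into_rtranclp)
  qed
qed

section \<open>Descent along binary digits\<close>

lemma binary_top:
  assumes "0 < n"
  obtains k m where "n = 2 ^ k + m" "m < (2::nat) ^ k"
proof -
  obtain k where "2 ^ k \<le> n" "n < 2 ^ (k + 1)"
    using ex_power_ivl1[of 2 n] assms by auto
  then show ?thesis using that[of k "n - 2 ^ k"] by simp
qed

text \<open>Unless \<open>Suc n\<close> equals \<open>2 ^ v\<close>, its valuation \<open>v\<close>
  lies below the leading digit \<open>k\<close> of \<open>n\<close>, so removing
  \<open>2 ^ k\<close> preserves the valuation and the induction runs down to size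
  \<open>2 ^ v - 1\<close>.\<close>

lemma oddset_core:
  assumes "oddset N n S" "2 * n \<le> N" "2 ^ v dvd Suc n" "\<not> 2 ^ Suc v dvd Suc n"
  shows "\<exists>K. oddset N (2 ^ v - 1) K \<and> (slides_to (2 ^ v))\<^sup>*\<^sup>* S K \<and>
    card (odd_up N n S) = card (odd_up N (2 ^ v - 1) K)"
  using assms
proof (induction n arbitrary: S rule: less_induct)
  case (less n)
  show ?case
  proof (cases "Suc n = 2 ^ v")
    case True
    then have "n = 2 ^ v - 1" by simp
    then show ?thesis using less.prems(1) by blast
  next
    case False
    have "n \<noteq> 0"
    proof
      assume "n = 0"
      then have "Suc n = 2 ^ v" using less.prems(3) by simp
      then show False using False by simp
    qed
    then obtain k m where n: "n = 2 ^ k + m" "m < 2 ^ k" using binary_top by blast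
    \<comment> \<open>Otherwise \<open>2 ^ k\<close> divides \<open>Suc m\<close>, which forces
      \<open>Suc m = 2 ^ k\<close> and \<open>Suc n = 2 ^ Suc k\<close>, a power of 2 whose
      valuation is \<open>Suc k\<close>; that is the case already settled.\<close>
    have vk: "v < k"
    proof (rule ccontr)
      assume "\<not> v < k"
      then have "(2::nat) ^ k dvd Suc n" using less.prems(3) by (meson le_imp_power_dvd dvd_trans not_le)
      then have "2 ^ k dvd Suc m" using n(1) by (simp flip: add_Suc_right)
      then have "Suc m = 2 ^ k" using n(2) by (auto dest!: dvd_imp_le)
      then have S: "Suc n = 2 ^ Suc k" using n by simp
      have "v \<le> Suc k"
        using less.prems(3) unfolding S by (simp add: power_dvd_imp_le)
      moreover have "\<not> Suc v \<le> Suc k"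
        using less.prems(4) unfolding S by (metis le_imp_power_dvd)
      ultimately have "v = Suc k" by simp
      then show False using S False by simp
    qed
    then have dk: "(2::nat) ^ Suc v dvd 2 ^ k" by (intro le_imp_power_dvd) simp
    have dk': "(2::nat) ^ v dvd 2 ^ k" using vk by (intro le_imp_power_dvd) simp
    have Sn: "Suc n = 2 ^ k + Suc m" using n(1) by simp
    have d1: "2 ^ v dvd Suc m"
      using less.prems(3) dvd_add_right_iff[OF dk', of "Suc m"] unfolding Sn by blast
    have d2: "\<not> 2 ^ Suc v dvd Suc m"
      using less.prems(4) dvd_add_right_iff[OF dk, of "Suc m"] unfolding Sn by blast
    have "Suc m \<noteq> 2 ^ k" using d2 dk by metis
    then have m: "Suc m < 2 ^ k" using n(2) by simp
    obtain x where x: "gaps (2 ^ k) S = {x}" "oddset N m (slide (2 ^ k) x S)"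
      "card (odd_up N n S) = card (odd_up N m (slide (2 ^ k) x S))"
      by (rule card_odd_up_reduce[OF less.prems(1) n(1) m]) (use n less.prems(2) in auto)
    have "m < n" "2 * m \<le> N" using n less.prems(2) by auto
    then obtain K where K: "oddset N (2 ^ v - 1) K" "(slides_to (2 ^ v))\<^sup>*\<^sup>* (slide (2 ^ k) x S) K"
      "card (odd_up N m (slide (2 ^ k) x S)) = card (odd_up N (2 ^ v - 1) K)"
      using less.IH[OF \<open>m < n\<close> x(2) _ d1 d2] by blast
    obtain s where s: "(2::nat) ^ k = Suc s * 2 ^ v"
    proof -
      have "(2::nat) ^ k = 2 ^ (k - v) * 2 ^ v" using vk by (simp flip: power_add)
      then show ?thesis using that[of "2 ^ (k - v) - 1"] by simp
    qed
    have "(slides_to (2 ^ v))\<^sup>*\<^sup>* S (slide (2 ^ k) x S)"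
      using slides_to_multiple[of "2 ^ v" x s S] x(1) unfolding s by simp
    then have "(slides_to (2 ^ v))\<^sup>*\<^sup>* S K" using K(2) by simp
    then show ?thesis using K x(3) by auto
  qed
qed

text \<open>If \<open>Suc n\<close> is not a power of 2, it shares its leading digit with
  \<open>n\<close> and all three sets pass to their cores. If it is one, \<open>T\<close> encodes a
  hook, and the parity of the branching rule decides.\<close>

lemma oddset_lower_unique:
  assumes "oddset N (Suc n) T" "oddset N n S" "unit_cover S T" "oddset N n S'" "unit_cover S' T"
  shows "S = S'"
  using assms
proof (induction n arbitrary: T S S' rule: less_induct)
  case (less n)
  obtain k m where n: "Suc n = 2 ^ k + m" "m < 2 ^ k" using binary_top[of "Suc n"] by blast
  define r :: nat where "r = 2 ^ k"
  have "0 < r" by (simp add: r_def)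
  obtain y where y: "gaps r T = {y}" and B: "oddset N m (slide r y T)"
    using oddset_reduce[OF less.prems(1) n] unfolding r_def by blast
  show ?case
  proof (cases m)
    case 0
    then have "slide r y T = {..<N}" using B beads_0 by (simp add: oddset_def)
    then have T: "T = insert (y + r) ({..<N} - {y})" and yT: "y \<notin> T"
      using slide_inv[OF \<open>0 < r\<close>, of y T] y by (auto simp: gaps_def)
    have "y + r \<notin> {..<N}"
    proof
      assume "y + r \<in> {..<N}"
      moreover have "y + r \<notin> slide r y T" using \<open>0 < r\<close> by (simp add: slide_def)
      ultimately show False using \<open>slide r y T = {..<N}\<close> by simp
    qed
    \<comment> \<open>\<open>T\<close> is the ground state with one bead raised from
      \<open>y\<close> to \<open>y + r\<close>; only that bead and the one just above the hole can
      step down. They are the ends of arm and leg of the hook.\<close>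
    then have g: "gaps 1 T \<subseteq> {y, y + r - 1}"
      unfolding gaps_def T using \<open>0 < r\<close> by auto
    obtain d d' where d: "d \<in> gaps 1 T" "S = slide 1 d T" and d': "d' \<in> gaps 1 T" "S' = slide 1 d' T"
      using less.prems by (auto simp: unit_cover_def)
    show ?thesis
    proof (rule ccontr)
      assume "S \<noteq> S'"
      then have "d \<noteq> d'" using d d' by auto
      then have "gaps 1 T = {d, d'}" using g d(1) d'(1) by auto
      \<comment> \<open>With exactly two sets below \<open>T\<close>, both odd, the branching rule
        would give \<open>1 + 1 = 0\<close> for the odd set \<open>T\<close>.\<close>
      moreover have "paths N (Suc n) T = (\<Sum>a\<in>gaps 1 T. paths N n (slide 1 a T))"
      proof -
        have "beads N (Suc n) T" using less.prems(1) by (simp add: oddset_def)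
        from paths_reduce[OF this, of 0 n] show ?thesis unfolding power_0 by simp
      qed
      ultimately have "paths N (Suc n) T = paths N n S + paths N n S'"
        using \<open>d \<noteq> d'\<close> d(2) d'(2) by simp
      then show False using less.prems by (simp add: oddset_def bit_add_self)
    qed
  next
    case (Suc m')
    have r: "2 \<le> r" using n(2) Suc by (simp add: r_def)
    have n': "n = 2 ^ k + m'" "m' < 2 ^ k" "m' < n" using n Suc by auto
    have red: "\<exists>x c. x \<in> gaps r S \<and> oddset N m' (slide r x S) \<and> unit_cover (slide r x S) (slide r y T) \<and>
        c \<in> slide r x S \<and> Suc c \<notin> slide r x S \<and> slide r y T = insert (Suc c) (slide r x S - {c}) \<and> swapped r c x y"
      if S: "oddset N n S" "unit_cover S T" for S
    proof -
      obtain x where x: "gaps r S = {x}" and A: "oddset N m' (slide r x S)"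
        using oddset_reduce[OF S(1) n'(1,2)] unfolding r_def by blast
      have "gaps r (slide r x S) = {}"
        using A n' gaps_empty[of N m' "slide r x S" r] by (simp add: oddset_def r_def)
      then obtain c where c: "c \<in> slide r x S" "Suc c \<notin> slide r x S"
        "slide r y T = insert (Suc c) (slide r x S - {c})" "swapped r c x y"
        using core_step[OF r x _ S(2) y] by blast
      then have "unit_cover (slide r x S) (slide r y T)" by (auto simp: unit_cover_iff)
      then show ?thesis using x A c by blast
    qed
    obtain x c where x: "x \<in> gaps r S" "oddset N m' (slide r x S)" "unit_cover (slide r x S) (slide r y T)"
       "c \<in> slide r x S" "Suc c \<notin> slide r x S" "slide r y T = insert (Suc c) (slide r x S - {c})" "swapped r c x y"
      using red[OF less.prems(2,3)] by blast
    obtain x' c' where x': "x' \<in> gaps r S'" "oddset N m' (slide r x' S')" "unit_cover (slide r x' S') (slide r y T)"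
       "c' \<in> slide r x' S'" "Suc c' \<notin> slide r x' S'" "slide r y T = insert (Suc c') (slide r x' S' - {c'})"
       "swapped r c' x' y"
      using red[OF less.prems(4,5)] by blast
    \<comment> \<open>By induction the two cores agree; then both steps start at the same
      \<open>c\<close>, and \<open>swapped_inj\<close> makes the gaps agree too.\<close>
    define A where "A = slide r x S"
    have A: "slide r x S = A" "slide r x' S' = A"
      using less.IH[OF n'(3) _ x(2,3) x'(2,3)] B Suc by (auto simp: A_def)
    have "c = c'"
      using x x' unfolding A by (intro unit_cover_bead_unique[of c A c']) simp_all
    have S: "S = insert (x + r) (A - {x})" "S' = insert (x' + r) (A - {x'})"
      using slide_inv[OF \<open>0 < r\<close> x(1)] slide_inv[OF \<open>0 < r\<close> x'(1)] A by simp_all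
    have "x \<in> A" "x + r \<notin> A" "x' \<in> A" "x' + r \<notin> A"
      using \<open>0 < r\<close> unfolding A(1)[symmetric] by (simp add: slide_def, simp add: slide_def)
        (use \<open>0 < r\<close> in \<open>simp add: A(1) flip: A(2), simp add: slide_def\<close>)+
    then have "x = x'"
      using x x' \<open>c = c'\<close> \<open>0 < r\<close> unfolding A by (intro swapped_inj[of r c x y x' A]) simp_all
    then show ?thesis using S by simp
  qed
qed

subsection \<open>Standard tableaux\<close>

lemma finite_standard_tableaux: "finite (standard_tableaux lam)"
proof (rule finite_subset)
  show "standard_tableaux lam \<subseteq> PiE (diagram lam) (\<lambda>_. {1..sum_list lam})"
    by (auto simp: standard_tableaux_def PiE_def bij_betw_def)
qed (intro finite_PiE, auto)

lemma tableau_le: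
  assumes "T \<in> standard_tableaux lam" "c \<in> diagram lam"
  shows "T c \<le> sum_list lam"
  using assms by (auto simp: standard_tableaux_def dest!: bij_betwE)

text \<open>Nothing can stand to the right of the largest entry or below it, so its cell is a
  corner.\<close>

lemma tableau_remove_max:
  assumes lam: "is_partition lam" and T: "T \<in> standard_tableaux lam"
    and c: "c \<in> diagram lam" "T c = sum_list lam"
  obtains mu where "removes_rim_hook 1 lam mu" "diagram mu = diagram lam - {c}"
    "restrict T (diagram mu) \<in> standard_tableaux mu"
proof -
  let ?D = "diagram lam"
  obtain a b where ab: "c = (a, b)" by (cases c)
  have bij: "bij_betw T ?D {1..sum_list lam}" and ext: "T \<in> extensional ?D"
    and rows: "\<And>i j. (i, Suc j) \<in> ?D \<Longrightarrow> T (i, j) < T (i, Suc j)"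
    and cols: "\<And>i j. (Suc i, j) \<in> ?D \<Longrightarrow> T (i, j) < T (Suc i, j)"
    using T by (auto simp: standard_tableaux_def)
  have right: "(a, Suc b) \<notin> ?D" and below: "(Suc a, b) \<notin> ?D"
    using rows[of a b] cols[of a b] tableau_le[OF T] c(2) by (auto simp: ab not_less[symmetric])
  obtain mu where mu: "is_partition mu" "diagram mu = ?D - {c}"
  proof (rule partition_of_diagram[of "?D - {c}"])
    fix i j i' j' assume ij: "(i, j) \<in> ?D - {c}" "i' \<le> i" "j' \<le> j"
    have "(i', j') \<noteq> c"
    proof
      assume "(i', j') = c"
      then have eq: "i' = a" "j' = b" by (auto simp: ab)
      then consider "a < i" | "i = a" "b < j" using ij ab by fastforce
      then show False
      proof cases
        case 1
        then show ?thesis using diagram_down[OF lam, of i j "Suc a" b] ij eq below by auto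
      next
        case 2
        then show ?thesis using diagram_down[OF lam, of i j a "Suc b"] ij eq right by auto
      qed
    qed
    then show "(i', j') \<in> ?D - {c}" using diagram_down[OF lam, of i j i' j'] ij by auto
  qed auto
  have K: "?D - diagram mu = {c}" using mu(2) c by auto
  then have rem: "removes_rim_hook 1 lam mu"
    using removes_rim_hook_1I[OF lam mu(1)] mu(2) by blast
  have size: "sum_list lam = sum_list mu + 1" by (rule removes_rim_hook_size[OF rem])
  have "bij_betw T (diagram mu) {1..sum_list mu}"
  proof -
    have "bij_betw T (?D - {c}) ({1..sum_list lam} - {T c})"
      using bij c bij_betwE[OF bij] by (intro bij_betw_DiffI) auto
    moreover have "{1..sum_list lam} - {T c} = {1..sum_list mu}" using c(2) size by auto
    ultimately show ?thesis using mu(2) by simp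
  qed
  then have "bij_betw (restrict T (diagram mu)) (diagram mu) {1..sum_list mu}"
    by (subst bij_betw_cong[of _ _ T]) auto
  moreover have "restrict T (diagram mu) (i, j) < restrict T (diagram mu) (i, Suc j)"
    if "(i, Suc j) \<in> diagram mu" for i j
  proof -
    have "(i, j) \<in> diagram mu" "(i, Suc j) \<in> ?D"
      using that diagram_down[OF mu(1) that, of i j] mu(2) by auto
    then show ?thesis using rows[of i j] that by simp
  qed
  moreover have "restrict T (diagram mu) (i, j) < restrict T (diagram mu) (Suc i, j)"
    if "(Suc i, j) \<in> diagram mu" for i j
  proof -
    have "(i, j) \<in> diagram mu" "(Suc i, j) \<in> ?D"
      using that diagram_down[OF mu(1) that, of i j] mu(2) by auto
    then show ?thesis using cols[of i j] that by simp
  qed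
  ultimately have "restrict T (diagram mu) \<in> standard_tableaux mu"
    unfolding standard_tableaux_def by simp
  then show ?thesis using that rem mu by blast
qed

lemma tableau_add_max:
  assumes rem: "removes_rim_hook 1 lam mu" and c: "diagram lam - diagram mu = {c}"
    and T: "T \<in> standard_tableaux mu"
  shows "T(c := sum_list lam) \<in> standard_tableaux lam"
proof -
  have lam: "is_partition lam" and mu: "is_partition mu" and sub: "diagram mu \<subseteq> diagram lam"
    using rem by (auto simp: removes_rim_hook_def)
  have D: "diagram lam = insert c (diagram mu)" "c \<notin> diagram mu" using c sub by auto
  have size: "sum_list lam = Suc (sum_list mu)" using removes_rim_hook_size[OF rem] by simp
  let ?T = "T(c := sum_list lam)"
  have bij: "bij_betw T (diagram mu) {1..sum_list mu}" and ext: "T \<in> extensional (diagram mu)"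
    and rows: "\<And>i j. (i, Suc j) \<in> diagram mu \<Longrightarrow> T (i, j) < T (i, Suc j)"
    and cols: "\<And>i j. (Suc i, j) \<in> diagram mu \<Longrightarrow> T (i, j) < T (Suc i, j)"
    using T by (auto simp: standard_tableaux_def)
  have "bij_betw ?T (diagram mu) {1..sum_list mu}"
    using bij D(2) by (subst bij_betw_cong[of _ _ T]) auto
  then have "bij_betw ?T (insert c (diagram mu)) (insert (sum_list lam) {1..sum_list mu})"
    by (subst insert_is_Un, subst insert_is_Un[of "sum_list lam"], intro bij_betw_combine)
      (auto simp: bij_betw_def size)
  moreover have "insert (sum_list lam) {1..sum_list mu} = {1..sum_list lam}"
    by (auto simp: size)
  ultimately have bijT: "bij_betw ?T (diagram lam) {1..sum_list lam}" using D by simp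
  have less: "?T d < ?T e" if "e \<in> diagram lam" "d \<in> diagram mu" "e \<in> diagram mu \<Longrightarrow> T d < T e" for d e
    using that D tableau_le[OF T that(2)] size by (auto simp: le_imp_less_Suc)
  have prev: "(i, j) \<in> diagram mu" if "(i, Suc j) \<in> diagram lam \<or> (Suc i, j) \<in> diagram lam" for i j
  proof (rule ccontr)
    assume "(i, j) \<notin> diagram mu"
    then have "(i, Suc j) \<notin> diagram mu" "(Suc i, j) \<notin> diagram mu"
      using diagram_down[OF mu, of i "Suc j" i j] diagram_down[OF mu, of "Suc i" j i j] by auto
    moreover have "(i, j) \<in> diagram lam"
      using that diagram_down[OF lam, of i "Suc j" i j] diagram_down[OF lam, of "Suc i" j i j] by auto
    ultimately show False using that D \<open>(i, j) \<notin> diagram mu\<close> by auto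
  qed
  have "?T (i, j) < ?T (i, Suc j)" if "(i, Suc j) \<in> diagram lam" for i j
    using less[OF that prev] rows that by blast
  moreover have "?T (i, j) < ?T (Suc i, j)" if "(Suc i, j) \<in> diagram lam" for i j
    using less[OF that prev] cols that by blast
  moreover have "?T \<in> extensional (diagram lam)"
    using ext D by (auto simp: extensional_def)
  ultimately show ?thesis using bijT unfolding standard_tableaux_def by blast
qed

lemma finite_removable: "finite {mu. removes_rim_hook p lam mu}"
proof (rule finite_imageD[of diagram])
  show "finite (diagram ` {mu. removes_rim_hook p lam mu})"
    by (rule finite_subset[of _ "Pow (diagram lam)"]) (auto simp: removes_rim_hook_def)
  show "inj_on diagram {mu. removes_rim_hook p lam mu}"
    by (auto simp: inj_on_def removes_rim_hook_def intro: diagram_inj)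
qed

text \<open>The branching rule: tableaux are sorted by the corner that holds the largest
  entry.\<close>

lemma num_syt_recurrence:
  assumes lam: "is_partition lam" and pos: "0 < sum_list lam"
  shows "num_syt lam = (\<Sum>mu | removes_rim_hook 1 lam mu. num_syt mu)"
proof -
  define corner where "corner mu = the_elem (diagram lam - diagram mu)" for mu
  have corner: "diagram lam - diagram mu = {corner mu}" "diagram mu = diagram lam - {corner mu}"
    if "removes_rim_hook 1 lam mu" for mu
  proof -
    obtain c where c: "diagram lam - diagram mu = {c}" "diagram mu \<subseteq> diagram lam"
      using \<open>removes_rim_hook 1 lam mu\<close> by (auto simp: removes_rim_hook_def card_1_singleton_iff)
    then show "diagram lam - diagram mu = {corner mu}" by (simp add: corner_def)
    then show "diagram mu = diagram lam - {corner mu}" using c by blast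
  qed
  let ?P = "SIGMA mu:{mu. removes_rim_hook 1 lam mu}. standard_tableaux mu"
  let ?f = "\<lambda>(mu, T). T(corner mu := sum_list lam)"
  have "bij_betw ?f ?P (standard_tableaux lam)"
    unfolding bij_betw_def
  proof (intro conjI set_eqI iffI inj_onI)
    fix x y assume "x \<in> ?P" "y \<in> ?P" and eq: "?f x = ?f y"
    then obtain mu T nu U where x: "x = (mu, T)" "removes_rim_hook 1 lam mu" "T \<in> standard_tableaux mu"
      and y: "y = (nu, U)" "removes_rim_hook 1 lam nu" "U \<in> standard_tableaux nu" by blast
    let ?V = "T(corner mu := sum_list lam)"
    have V: "?V = U(corner nu := sum_list lam)" using eq x y by simp
    have "?V \<in> standard_tableaux lam" using tableau_add_max[OF x(2) corner(1)[OF x(2)] x(3)] .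
    then have "inj_on ?V (diagram lam)" by (auto simp: standard_tableaux_def bij_betw_def)
    moreover have "?V (corner mu) = ?V (corner nu)"
    proof -
      have "?V (corner nu) = sum_list lam" unfolding V by simp
      then show ?thesis by simp
    qed
    moreover have "corner mu \<in> diagram lam" "corner nu \<in> diagram lam"
      using corner(1)[OF x(2)] corner(1)[OF y(2)] by auto
    ultimately have cc: "corner mu = corner nu" by (rule inj_onD)
    then have "diagram mu = diagram nu" using corner(2)[OF x(2)] corner(2)[OF y(2)] by simp
    then have mn: "mu = nu" using x(2) y(2) by (auto simp: removes_rim_hook_def intro: diagram_inj)
    have "T = U"
    proof (rule extensionalityI[of _ "diagram mu"])
      show "T \<in> extensional (diagram mu)" "U \<in> extensional (diagram mu)"
        using x y mn by (auto simp: standard_tableaux_def)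
      fix d assume "d \<in> diagram mu"
      then have "d \<noteq> corner mu" using corner(2)[OF x(2)] by blast
      then show "T d = U d" using fun_cong[OF V, of d] cc by simp
    qed
    then show "x = y" using x y mn by simp
  next
    fix U assume "U \<in> ?f ` ?P"
    then show "U \<in> standard_tableaux lam"
      using tableau_add_max[OF _ corner(1)] by auto
  next
    fix U assume U: "U \<in> standard_tableaux lam"
    then have "sum_list lam \<in> U ` diagram lam"
      using pos by (auto simp: standard_tableaux_def bij_betw_def)
    then obtain c where c: "c \<in> diagram lam" "U c = sum_list lam" by auto
    obtain mu where mu: "removes_rim_hook 1 lam mu" "diagram mu = diagram lam - {c}"
      "restrict U (diagram mu) \<in> standard_tableaux mu"
      using tableau_remove_max[OF lam U c] .
    have "corner mu = c" using mu(2) c(1) corner(1)[OF mu(1)] by auto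
    moreover have "U d = undefined" if "d \<notin> diagram lam" for d
      using U that by (cases d) (simp add: standard_tableaux_def extensional_def)
    ultimately have "U = ?f (mu, restrict U (diagram mu))"
      using mu(2) c by (auto simp: fun_eq_iff restrict_def)
    then show "U \<in> ?f ` ?P" using mu by blast
  qed
  then have "num_syt lam = card ?P" unfolding num_syt_def by (simp add: bij_betw_same_card)
  also have "\<dots> = (\<Sum>mu | removes_rim_hook 1 lam mu. num_syt mu)"
    by (subst card_SigmaI) (auto simp: finite_removable finite_standard_tableaux num_syt_def)
  finally show ?thesis .
qed

lemma num_syt_Nil: "num_syt [] = 1"
proof -
  have "standard_tableaux [] = {\<lambda>_. undefined}"
    by (auto simp: standard_tableaux_def diagram_def bij_betw_def)
  then show ?thesis by (simp add: num_syt_def)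
qed

text \<open>Both sides obey the branching rule, with rim hooks of length one matching unit slides,
  and both are 1 for the empty partition.\<close>

lemma num_syt_paths:
  assumes "is_partition lam" "length lam \<le> N"
  shows "of_nat (num_syt lam) = paths N (sum_list lam) (bset N lam)"
  using assms
proof (induction "sum_list lam" arbitrary: lam)
  case 0
  then have "lam = []" by (metis sum_list_eq_0_partition)
  then show ?case by (simp add: num_syt_Nil paths_def bset_Nil)
next
  case (Suc n)
  let ?S = "bset N lam" and ?R = "{mu. removes_rim_hook 1 lam mu}"
  note iff = removes_rim_hook_iff_slide[OF Suc.prems, of 1, OF zero_less_one]
  have R: "is_partition mu" "length mu \<le> N" "sum_list mu = n" if "mu \<in> ?R" for mu
    using that iff[of mu] removes_rim_hook_size[of 1 lam mu] Suc(2) by auto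
  have bS: "beads N (Suc n) ?S" using beads_bset[OF Suc.prems] Suc(2) by simp
  have inj: "inj_on (\<lambda>a. slide 1 a ?S) (gaps 1 ?S)"
  proof (rule inj_onI)
    fix a b assume "a \<in> gaps 1 ?S" "b \<in> gaps 1 ?S" "slide 1 a ?S = slide 1 b ?S"
    then show "a = b" unfolding gaps_def slide_def by blast
  qed
  have im: "bset N ` ?R = (\<lambda>a. slide 1 a ?S) ` gaps 1 ?S"
  proof (intro set_eqI iffI)
    fix T assume "T \<in> (\<lambda>a. slide 1 a ?S) ` gaps 1 ?S"
    then obtain a where a: "a \<in> gaps 1 ?S" "T = slide 1 a ?S" by auto
    obtain m where "beads N m T" using beads_slide[OF bS a(1)] a(2) by metis
    then obtain mu where "is_partition mu" "length mu \<le> N" "bset N mu = T"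
      using beads_partition by metis
    then show "T \<in> bset N ` ?R" using a iff[of mu] by auto
  qed (use iff in auto)
  have "of_nat (num_syt lam) = (\<Sum>mu\<in>?R. of_nat (num_syt mu) :: bit)"
    using num_syt_recurrence[OF Suc.prems(1)] Suc(2) by simp
  also have "\<dots> = (\<Sum>mu\<in>?R. paths N n (bset N mu))"
    using Suc.hyps(1) R by (intro sum.cong refl) (metis (no_types))
  also have "\<dots> = sum (paths N n) (bset N ` ?R)"
    using R by (subst sum.reindex) (auto simp: inj_on_def intro: bset_inj)
  also have "\<dots> = (\<Sum>a\<in>gaps 1 ?S. paths N n (slide 1 a ?S))"
    unfolding im by (subst sum.reindex[OF inj]) simp
  also have "\<dots> = paths N (Suc n) ?S"
    using paths_reduce[OF bS, of 0 n] unfolding power_0 by simp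
  finally show ?case using Suc(2) by simp
qed

lemma of_nat_bit_eq_1: "(of_nat n :: bit) = 1 \<longleftrightarrow> odd n"
proof (induction n)
  case (Suc n)
  then show ?case by (cases "of_nat n :: bit") auto
qed simp

lemma odd_partition_iff:
  assumes "is_partition lam" "length lam \<le> N"
  shows "lam \<in> odd_partitions_of n \<longleftrightarrow> oddset N n (bset N lam)"
proof -
  have "lam \<in> odd_partitions_of n \<longleftrightarrow> sum_list lam = n \<and> paths N (sum_list lam) (bset N lam) = 1"
    using assms num_syt_paths[OF assms]
    by (auto simp: odd_partitions_of_def odd_partitions_def simp flip: of_nat_bit_eq_1)
  also have "\<dots> \<longleftrightarrow> oddset N n (bset N lam)"
    using beads_bset[OF assms] sum_bset[OF assms] by (auto simp: oddset_def beads_def)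
  finally show ?thesis .
qed

subsection \<open>Trees graded by a height function\<close>

lemma connected_graphI:
  assumes "r \<in> V" "\<And>u w. E u w \<Longrightarrow> E w u"
    and reach: "\<And>u. u \<in> V \<Longrightarrow> (\<lambda>a b. a \<in> V \<and> b \<in> V \<and> E a b)\<^sup>*\<^sup>* u r"
  shows "connected_graph V E"
proof -
  let ?R = "\<lambda>a b. a \<in> V \<and> b \<in> V \<and> E a b"
  have path: "\<exists>xs. simple_path V E xs \<and> hd xs = u \<and> last xs = w" if "?R\<^sup>*\<^sup>* u w" "u \<in> V" for u w
    using that
  proof (induction rule: rtranclp_induct)
    case base
    then show ?case by (intro exI[of _ "[u]"]) (simp add: simple_path_def)
  next
    case (step w z)
    then obtain xs where xs: "simple_path V E xs" "hd xs = u" "last xs = w" by blast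
    show ?case
    \<comment> \<open>A walk that returns to a vertex of its path is cut back to that vertex, so the
      path stays simple.\<close>
    proof (cases "z \<in> set xs")
      case True
      then obtain ys zs where "xs = ys @ z # zs" by (auto dest: split_list)
      then show ?thesis
        using xs by (intro exI[of _ "ys @ [z]"])
          (auto simp: simple_path_def successively_append_iff hd_append)
    next
      case False
      then show ?thesis
        using xs step by (intro exI[of _ "xs @ [z]"])
          (auto simp: simple_path_def successively_append_iff)
    qed
  qed
  have "symp ?R" using assms(2) by (auto simp: symp_def)
  then have sym: "?R\<^sup>*\<^sup>* w u" if "?R\<^sup>*\<^sup>* u w" for u w
    using that by (metis symp_rtranclp sympD)
  have "?R\<^sup>*\<^sup>* u w" if "u \<in> V" "w \<in> V" for u w
    using reach[OF that(1)] sym[OF reach[OF that(2)]] by simp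
  then show ?thesis
    unfolding connected_graph_def using path assms(1) by blast
qed

text \<open>A neighbour one level lower acts as the parent. Only its uniqueness is assumed, which
  suffices for acyclicity; connectedness comes from \<open>connected_graphI\<close>.\<close>

locale graded_forest =
  fixes V :: "'a set" and E :: "'a \<Rightarrow> 'a \<Rightarrow> bool" and h :: "'a \<Rightarrow> nat"
  assumes sym: "\<And>u w. E u w \<Longrightarrow> E w u"
    and graded: "\<And>u w. E u w \<Longrightarrow> h w = Suc (h u) \<or> h u = Suc (h w)"
    and parent_unique: "\<And>u w w'. u \<in> V \<Longrightarrow> w \<in> V \<Longrightarrow> w' \<in> V \<Longrightarrow> E u w \<Longrightarrow> E u w' \<Longrightarrow>
      h u = Suc (h w) \<Longrightarrow> h u = Suc (h w') \<Longrightarrow> w = w'"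
begin

lemma simple_path_nth:
  assumes "simple_path V E xs"
  shows "\<And>i. i < length xs \<Longrightarrow> xs ! i \<in> V"
    and "\<And>i. Suc i < length xs \<Longrightarrow> E (xs ! i) (xs ! Suc i)"
    and "\<And>i j. i < length xs \<Longrightarrow> j < length xs \<Longrightarrow> xs ! i = xs ! j \<Longrightarrow> i = j"
  using assms by (auto simp: simple_path_def successively_conv_nth nth_eq_iff_index_eq)

text \<open>A peak of a simple path would have two different parents.\<close>

lemma simple_path_ascending:
  assumes p: "simple_path V E xs" and up: "h (xs ! 1) = Suc (h (xs ! 0))" and i: "i < length xs"
  shows "h (xs ! i) = h (xs ! 0) + i"
  using i
proof (induction i rule: less_induct)
  case (less i)
  note nth = simple_path_nth[OF p]
  consider "i = 0" | "i = 1" | j where "i = Suc (Suc j)"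
    by (metis One_nat_def not0_implies_Suc)
  then show ?case
  proof cases
    case 3
    then have j: "h (xs ! j) = h (xs ! 0) + j" "h (xs ! Suc j) = h (xs ! 0) + Suc j"
      using less.IH[of j] less.IH[of "Suc j"] less.prems by simp_all
    have "E (xs ! Suc j) (xs ! j)" "E (xs ! Suc j) (xs ! i)"
      using nth(2)[of j] nth(2)[of "Suc j"] 3 less.prems sym by simp_all
    moreover have "xs ! j \<noteq> xs ! i" using nth(3)[of j i] 3 less.prems by auto
    ultimately have "h (xs ! Suc j) \<noteq> Suc (h (xs ! i))"
      using parent_unique[of "xs ! Suc j" "xs ! j" "xs ! i"] nth(1) j 3 less.prems by auto
    then show ?thesis using graded[OF \<open>E (xs ! Suc j) (xs ! i)\<close>] j 3 by simp
  qed (use up in simp_all)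
qed

text \<open>A path that starts upwards rises by at least 2 overall, too much for a closing edge. So
  both end edges lead down into the path, and the higher end has two parents: its neighbour on the
  path and the other end.\<close>

lemma acyclic_graded: "acyclic_graph V E"
  unfolding acyclic_graph_def
proof
  assume "\<exists>xs. simple_path V E xs \<and> length xs \<ge> 3 \<and> E (last xs) (hd xs)"
  then obtain xs where p: "simple_path V E xs" and len: "length xs \<ge> 3" and cl: "E (last xs) (hd xs)"
    by blast
  define n where "n = length xs - 1"
  have n: "length xs = Suc n" "2 \<le> n" using len by (auto simp: n_def)
  have hl: "hd xs = xs ! 0" "last xs = xs ! n"
  proof -
    have "xs \<noteq> []" using len by auto
    then show "hd xs = xs ! 0" "last xs = xs ! n" by (simp_all add: hd_conv_nth last_conv_nth n_def)
  qed
  have prev: "simple_path V E (rev xs)"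
    using p sym by (auto simp: simple_path_def successively_rev intro: successively_mono)
  note nth = simple_path_nth[OF p]
  have rev: "rev xs ! 0 = xs ! n" "rev xs ! 1 = xs ! (n - 1)" "rev xs ! n = xs ! 0"
    using n by (simp_all add: rev_nth)
  have e: "E (xs ! 0) (xs ! 1)" "E (xs ! n) (xs ! (n - 1))" "E (xs ! n) (xs ! 0)" "E (xs ! 0) (xs ! n)"
    using nth(2)[of 0] nth(2)[of "n - 1"] n cl hl sym by simp_all
  have d: "xs ! 1 \<noteq> xs ! n" "xs ! 0 \<noteq> xs ! (n - 1)"
  proof -
    have "1 < length xs" "n < length xs" "n - 1 < length xs" "0 < length xs" "1 \<noteq> n" "0 \<noteq> n - 1"
      using n by auto
    then show "xs ! 1 \<noteq> xs ! n" "xs ! 0 \<noteq> xs ! (n - 1)" using nth(3) by blast+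
  qed
  have inV: "xs ! 0 \<in> V" "xs ! 1 \<in> V" "xs ! n \<in> V" "xs ! (n - 1) \<in> V"
    using nth(1) n by auto
  have a: "h (xs ! 1) \<noteq> Suc (h (xs ! 0))"
  proof
    assume "h (xs ! 1) = Suc (h (xs ! 0))"
    from simple_path_ascending[OF p this, of n] show False using graded[OF e(3)] n by simp
  qed
  have b: "h (xs ! (n - 1)) \<noteq> Suc (h (xs ! n))"
  proof
    assume "h (xs ! (n - 1)) = Suc (h (xs ! n))"
    with simple_path_ascending[OF prev, of n] show False using graded[OF e(3)] n rev by simp
  qed
  from graded[OF e(3)] show False
  proof
    assume "h (xs ! 0) = Suc (h (xs ! n))"
    then show False
      using parent_unique[OF inV(1,2,3) e(1,4)] graded[OF e(1)] a d by auto
  next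
    assume "h (xs ! n) = Suc (h (xs ! 0))"
    then show False
      using parent_unique[OF inV(3,1,4) e(3,2)] graded[OF e(2)] b d by auto
  qed
qed

text \<open>Height 0 at the root forces the first edge upwards, and then
  \<open>simple_path_ascending\<close> forces all the others.\<close>

lemma children_graded:
  assumes "h r = 0"
  shows "children V E r u \<subseteq> {w \<in> V. E u w \<and> h w = Suc (h u)}"
proof
  fix w assume "w \<in> children V E r u"
  then obtain xs where p: "simple_path V E (xs @ [w])" and xs: "xs \<noteq> []" "hd xs = r" "last xs = u"
    by (auto simp: children_def)
  note nth = simple_path_nth[OF p]
  obtain n where n: "length xs = Suc n" using xs(1) by (cases "length xs") auto
  have z: "(xs @ [w]) ! 0 = r" "(xs @ [w]) ! n = u" "(xs @ [w]) ! Suc n = w"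
    using xs n by (auto simp: nth_append hd_conv_nth last_conv_nth)
  have "h ((xs @ [w]) ! 1) = Suc (h ((xs @ [w]) ! 0))"
    using graded[OF nth(2)[of 0]] n z(1) assms by simp
  from simple_path_ascending[OF p this] have "h u = n" "h w = Suc n"
    using z n assms by (metis add_0 length_append_singleton less_SucI lessI)+
  then show "w \<in> {w \<in> V. E u w \<and> h w = Suc (h u)}"
    using nth(1)[of "Suc n"] nth(2)[of n] z n by simp
qed

end

subsection \<open>Odd partitions\<close>

lemma is_hook_iff:
  assumes lam: "is_partition lam"
  shows "is_hook lam \<longleftrightarrow> (0, 0) \<in> diagram lam \<and> (1, 1) \<notin> diagram lam"
proof
  assume "is_hook lam"
  then show "(0, 0) \<in> diagram lam \<and> (1, 1) \<notin> diagram lam"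
    by (auto simp: is_hook_def diagram_def)
next
  assume *: "(0, 0) \<in> diagram lam \<and> (1, 1) \<notin> diagram lam"
  then obtain x xs where lx: "lam = x # xs" "0 < x" by (cases lam) (auto simp: diagram_def)
  have "y = 1" if "y \<in> set xs" for y
  proof -
    from that obtain i where i: "i < length xs" "y = xs ! i" by (auto simp: in_set_conv_nth)
    then have y: "y = row lam (Suc i)" by (simp add: lx row_def)
    then have "y \<le> row lam 1" using row_antimono[OF lam, of 1 "Suc i"] by simp
    also have "\<dots> \<le> 1" using * by (simp add: mem_diagram not_less)
    finally have "y \<le> 1" .
    moreover have "0 < y" using row_pos_iff[OF lam, of "Suc i"] i y by (simp add: lx)
    ultimately show ?thesis by simp
  qed
  then have "xs = replicate (length xs) 1" by (simp add: replicate_length_same)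
  then have "lam = (x - 1 + 1) # replicate (length xs) 1" using lx by simp
  then show "is_hook lam" unfolding is_hook_def by blast
qed

lemma is_hook_partition: "is_hook lam \<Longrightarrow> is_partition lam"
  by (auto simp: is_hook_def is_partition_def sorted_wrt_iff_nth_less nth_Cons split: nat.splits)

text \<open>A diagram contains a square iff it contains the cell \<open>(1, 1)\<close>; without that
  cell, every cell is joined to \<open>(0, 0)\<close> along the first row or column.\<close>

lemma rim_hook_to_Nil_iff_hook:
  assumes lam: "is_partition lam" "0 < sum_list lam"
  shows "removes_rim_hook (sum_list lam) lam [] \<longleftrightarrow> is_hook lam"
proof -
  let ?D = "diagram lam"
  have Nil: "is_partition []" "diagram [] = {}" by (auto simp: is_partition_def diagram_def)
  have "?D \<noteq> {}" using lam(2) by (metis card_diagram card.empty less_irrefl)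
  then have 00: "(0, 0) \<in> ?D" using diagram_down[OF lam(1)] by fastforce
  have sq: "contains_square ?D \<longleftrightarrow> (1, 1) \<in> ?D"
  proof
    assume "contains_square ?D"
    then obtain i j where "(Suc i, Suc j) \<in> ?D" by (auto simp: contains_square_def)
    then show "(1, 1) \<in> ?D" using diagram_down[OF lam(1), of "Suc i" "Suc j" 1 1] by simp
  next
    assume "(1, 1) \<in> ?D"
    then have "{(0, 0), (0, Suc 0), (Suc 0, 0), (Suc 0, Suc 0)} \<subseteq> ?D"
      using diagram_down[OF lam(1), of 1 1] by simp
    then show "contains_square ?D" unfolding contains_square_def by blast
  qed
  have conn: "cells_connected ?D" if hook: "(1, 1) \<notin> ?D"
  proof -
    let ?E = "{(a, b). a \<in> ?D \<and> b \<in> ?D \<and> cell_adj a b}"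
    have row: "((0, j), (0, 0)) \<in> ?E\<^sup>*" if "(0, j) \<in> ?D" for j
      using that
    proof (induction j)
      case (Suc j)
      then have j: "(0, j) \<in> ?D" using diagram_down[OF lam(1), of 0 "Suc j" 0 j] by simp
      then have "((0, Suc j), (0, j)) \<in> ?E" using Suc.prems by (simp add: cell_adj_def)
      then show ?case using Suc.IH[OF j] by (rule converse_rtrancl_into_rtrancl)
    qed simp
    have col: "((i, 0), (0, 0)) \<in> ?E\<^sup>*" if "(i, 0) \<in> ?D" for i
      using that
    proof (induction i)
      case (Suc i)
      then have i: "(i, 0) \<in> ?D" using diagram_down[OF lam(1), of "Suc i" 0 i 0] by simp
      then have "((Suc i, 0), (i, 0)) \<in> ?E" using Suc.prems by (simp add: cell_adj_def)
      then show ?case using Suc.IH[OF i] by (rule converse_rtrancl_into_rtrancl)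
    qed simp
    have to0: "(c, (0, 0)) \<in> ?E\<^sup>*" if c: "c \<in> ?D" for c
    proof -
      obtain i j where ij: "c = (i, j)" by (cases c)
      have "i = 0 \<or> j = 0"
      proof (rule ccontr)
        assume "\<not> ?thesis"
        then have "(1, 1) \<in> ?D"
          using diagram_down[OF lam(1), of i j 1 1] c ij by simp
        then show False using hook by simp
      qed
      then show ?thesis using row col c ij by auto
    qed
    have "sym ?E" by (auto simp: sym_def cell_adj_sym)
    then have "(d, c) \<in> ?E\<^sup>*" if "(c, d) \<in> ?E\<^sup>*" for c d
      using that by (meson sym_rtrancl symD)
    then show ?thesis
      unfolding cells_connected_def using to0 by (meson rtrancl_trans)
  qed
  show ?thesis
    using lam Nil 00 sq conn by (auto simp: removes_rim_hook_def is_hook_iff card_diagram)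
qed

text \<open>Removing a rim hook of length \<open>2 ^ v\<close> leaves the empty partition, which is
  odd. So \<open>mu\<close> is odd iff such a rim hook exists, that is, iff the whole diagram is
  one.\<close>

lemma odd_power_two_iff_hook:
  assumes mu: "is_partition mu" "sum_list mu = 2 ^ v"
  shows "mu \<in> odd_partitions_of (2 ^ v) \<longleftrightarrow> is_hook mu"
proof -
  define N where "N = length mu"
  let ?S = "bset N mu" and ?r = "2 ^ v :: nat"
  have len: "length mu \<le> N" by (simp add: N_def)
  have b: "beads N ?r ?S" using beads_bset[OF mu(1) len] mu(2) by simp
  have ground: "slide ?r a ?S = {..<N}" if a: "a \<in> gaps ?r ?S" for a
  proof -
    obtain m where "?r = m + ?r" "beads N m (slide ?r a ?S)" using beads_slide[OF b a] .
    then show ?thesis using beads_0 by simp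
  qed
  have "oddset N ?r ?S \<longleftrightarrow> gaps ?r ?S \<noteq> {}"
  proof
    assume "oddset N ?r ?S"
    then show "gaps ?r ?S \<noteq> {}" using oddset_reduce[of N ?r ?S v 0] by auto
  next
    assume "gaps ?r ?S \<noteq> {}"
    then obtain a where a: "a \<in> gaps ?r ?S" by auto
    have "oddset N 0 (slide ?r a ?S)" by (simp add: ground[OF a] oddset_def beads_0 paths_def)
    then show "oddset N ?r ?S" using oddset_lift(1)[OF b, of v 0 a] a by simp
  qed
  also have "\<dots> \<longleftrightarrow> removes_rim_hook ?r mu []"
    using removes_rim_hook_iff_slide[OF mu(1) len, of ?r "[]"] ground
    by (auto simp: bset_Nil is_partition_def)
  also have "\<dots> \<longleftrightarrow> is_hook mu" using rim_hook_to_Nil_iff_hook[OF mu(1)] mu(2) by simp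
  finally show ?thesis using odd_partition_iff[OF mu(1) len] by simp
qed

section \<open>From beta-sets back to partitions\<close>

lemma card_covers_eq_card_odd_up:
  assumes lam: "is_partition lam" "sum_list lam = n" and N: "Suc n \<le> N"
  shows "card (upper_covers lam \<inter> odd_partitions_of (Suc n)) = card (odd_up N n (bset N lam))"
proof -
  have len: "length lam \<le> N" using length_le_sum_list[OF lam(1)] lam N by simp
  have C: "is_partition mu \<and> length mu \<le> N" if "mu \<in> odd_partitions_of (Suc n)" for mu
    using that length_le_sum_list[of mu] N by (auto simp: odd_partitions_of_def odd_partitions_def)
  have unit_cover: "mu \<in> upper_covers lam \<longleftrightarrow> unit_cover (bset N lam) (bset N mu)"
    if "is_partition mu" "length mu \<le> N" for mu
    using removes_rim_hook_iff_slide[OF that, of 1 lam] lam len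
    by (simp add: upper_cover_iff unit_cover_def)
  have "bij_betw (bset N) (upper_covers lam \<inter> odd_partitions_of (Suc n)) (odd_up N n (bset N lam))"
  proof (rule bij_betw_imageI)
    show "inj_on (bset N) (upper_covers lam \<inter> odd_partitions_of (Suc n))"
      by (rule inj_onI) (use C bset_inj in blast)
    show "bset N ` (upper_covers lam \<inter> odd_partitions_of (Suc n)) = odd_up N n (bset N lam)"
    proof (intro set_eqI iffI)
      fix T assume "T \<in> bset N ` (upper_covers lam \<inter> odd_partitions_of (Suc n))"
      then obtain mu where mu: "T = bset N mu" "mu \<in> upper_covers lam" "mu \<in> odd_partitions_of (Suc n)"
        by blast
      then show "T \<in> odd_up N n (bset N lam)"
        using C[OF mu(3)] unit_cover[of mu] odd_partition_iff[of mu N "Suc n"] by (simp add: odd_up_def)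
    next
      fix T assume T: "T \<in> odd_up N n (bset N lam)"
      then have "beads N (Suc n) T" by (simp add: odd_up_def oddset_def)
      then obtain mu where mu: "is_partition mu" "length mu \<le> N" "bset N mu = T"
        by (rule beads_partition)
      then have "mu \<in> upper_covers lam \<inter> odd_partitions_of (Suc n)"
        using T unit_cover[of mu] odd_partition_iff[of mu N "Suc n"] by (simp add: odd_up_def)
      then show "T \<in> bset N ` (upper_covers lam \<inter> odd_partitions_of (Suc n))"
        using mu(3) by blast
    qed
  qed
  then show ?thesis by (rule bij_betw_same_card)
qed

lemma removes_rtranclp_iff_slides_to:
  assumes lam: "is_partition lam" "length lam \<le> N" and p: "0 < p"
  shows "(removes_rim_hook p)\<^sup>*\<^sup>* lam mu \<longleftrightarrow>
    is_partition mu \<and> length mu \<le> N \<and> (slides_to p)\<^sup>*\<^sup>* (bset N lam) (bset N mu)"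
proof
  assume "(removes_rim_hook p)\<^sup>*\<^sup>* lam mu"
  then show "is_partition mu \<and> length mu \<le> N \<and> (slides_to p)\<^sup>*\<^sup>* (bset N lam) (bset N mu)"
  proof (induction rule: rtranclp_induct)
    case (step mu nu)
    then have "is_partition nu" "length nu \<le> N" "slides_to p (bset N mu) (bset N nu)"
      using removes_rim_hook_iff_slide[of mu N p nu] p by (auto simp: slides_to_def)
    then show ?case using step.IH by auto
  qed (use lam in simp)
next
  have "\<forall>mu. is_partition mu \<and> length mu \<le> N \<and> bset N mu = K \<longrightarrow> (removes_rim_hook p)\<^sup>*\<^sup>* lam mu"
    if "(slides_to p)\<^sup>*\<^sup>* (bset N lam) K" "K = bset N mu" for K mu
    using that(1)
  proof (induction rule: rtranclp_induct)
    case base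
    then show ?case using bset_inj[OF lam(1) _ lam(2)] by auto
  next
    case (step K L)
    \<comment> \<open>Every set reached by slides is again the beta-set of a partition with at most
      \<open>N\<close> rows, so the path of sets lifts to a path of partitions.\<close>
    have "\<exists>n. beads N n K"
      using step(1)
    proof (induction rule: rtranclp_induct)
      case base
      then show ?case using beads_bset[OF lam] by blast
    next
      case (step K L)
      then show ?case unfolding slides_to_def by (metis beads_slide)
    qed
    then obtain nu where nu: "is_partition nu" "length nu \<le> N" "bset N nu = K"
      using beads_partition by metis
    then have "(removes_rim_hook p)\<^sup>*\<^sup>* lam nu" using step.IH by blast
    moreover have "removes_rim_hook p nu mu" if "is_partition mu" "length mu \<le> N" "bset N mu = L" for mu
      using removes_rim_hook_iff_slide[OF nu(1,2) p, of mu] nu(3) that step(2) by (auto simp: slides_to_def)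
    ultimately show ?case by (auto intro: rtranclp.rtrancl_into_rtrancl)
  qed
  moreover assume "is_partition mu \<and> length mu \<le> N \<and> (slides_to p)\<^sup>*\<^sup>* (bset N lam) (bset N mu)"
  ultimately show "(removes_rim_hook p)\<^sup>*\<^sup>* lam mu" by blast
qed

text \<open>Confluence, in the form of \<open>slides_to_normal_unique\<close>, justifies the
  definite description in \<open>p_core\<close>.\<close>

lemma p_core_eqI:
  assumes lam: "is_partition lam" "length lam \<le> N" and p: "0 < p"
    and kap: "is_partition kap" "length kap \<le> N" "(slides_to p)\<^sup>*\<^sup>* (bset N lam) (bset N kap)"
      "gaps p (bset N kap) = {}"
  shows "p_core p lam = kap"
  unfolding p_core_def
proof (rule the_equality)
  have normal: "(\<nexists>nu. removes_rim_hook p mu nu) \<longleftrightarrow> gaps p (bset N mu) = {}"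
    if mu: "is_partition mu" "length mu \<le> N" for mu
  proof
    assume *: "\<nexists>nu. removes_rim_hook p mu nu"
    show "gaps p (bset N mu) = {}"
    proof (rule equals0I)
      fix a assume a: "a \<in> gaps p (bset N mu)"
      then obtain m where "beads N m (slide p a (bset N mu))" using beads_slide[OF beads_bset[OF mu]] by metis
      then obtain nu where "is_partition nu" "length nu \<le> N" "bset N nu = slide p a (bset N mu)"
        using beads_partition by metis
      then show False using * a removes_rim_hook_iff_slide[OF mu p, of nu] by blast
    qed
  qed (use removes_rim_hook_iff_slide[OF mu p] in blast)
  show "(removes_rim_hook p)\<^sup>*\<^sup>* lam kap \<and> (\<nexists>nu. removes_rim_hook p kap nu)"
    using removes_rtranclp_iff_slides_to[OF lam p, of kap] normal[OF kap(1,2)] kap by simp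
  show "mu = kap" if "(removes_rim_hook p)\<^sup>*\<^sup>* lam mu \<and> (\<nexists>nu. removes_rim_hook p mu nu)" for mu
  proof -
    have mu: "is_partition mu" "length mu \<le> N" "(slides_to p)\<^sup>*\<^sup>* (bset N lam) (bset N mu)"
      using that removes_rtranclp_iff_slides_to[OF lam p, of mu] by auto
    then have "bset N mu = bset N kap"
      using that slides_to_normal_unique[OF kap(3,4) mu(3)] normal[OF mu(1,2)] by simp
    then show ?thesis using mu kap bset_inj by blast
  qed
qed

lemma odd_covers_core:
  assumes lam: "lam \<in> odd_partitions_of n" and v: "v = multiplicity 2 (n + 1)"
  obtains kap where "is_partition kap" "sum_list kap = 2 ^ v - 1" "p_core (2 ^ v) lam = kap"
    "card (upper_covers lam \<inter> odd_partitions_of (n + 1)) =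
      card (upper_covers kap \<inter> odd_partitions_of (2 ^ v))"
proof -
  \<comment> \<open>Large enough both for the descent, which needs \<open>2 * n \<le> N\<close>, and
    for every partition of \<open>n + 1\<close> to fit into \<open>N\<close> rows.\<close>
  define N where "N = 2 * n + 2"
  have l: "is_partition lam" "sum_list lam = n"
    using lam by (auto simp: odd_partitions_of_def odd_partitions_def)
  have len: "length lam \<le> N" using length_le_sum_list[OF l(1)] l(2) by (simp add: N_def)
  have d: "2 ^ v dvd Suc n" "\<not> 2 ^ Suc v dvd Suc n"
    using multiplicity_dvd[of 2 "n + 1"] power_dvd_iff_le_multiplicity[of "n + 1" 2 "Suc v"] v by auto
  have "2 ^ v \<le> Suc n" using d(1) by (intro dvd_imp_le) auto
  have "oddset N n (bset N lam)" using odd_partition_iff[OF l(1) len] lam by simp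
  then obtain K where K: "oddset N (2 ^ v - 1) K" "(slides_to (2 ^ v))\<^sup>*\<^sup>* (bset N lam) K"
    "card (odd_up N n (bset N lam)) = card (odd_up N (2 ^ v - 1) K)"
    using oddset_core[of N n "bset N lam" v] d by (auto simp: N_def)
  then have bK: "beads N (2 ^ v - 1) K" by (simp add: oddset_def)
  then obtain kap where kap: "is_partition kap" "length kap \<le> N" "bset N kap = K" "sum_list kap = 2 ^ v - 1"
    by (rule beads_partition)
  \<comment> \<open>A partition of \<open>2 ^ v - 1\<close> is too small to lose a rim hook of
    length \<open>2 ^ v\<close>, so \<open>kap\<close> is a core.\<close>
  have "gaps (2 ^ v) K = {}" using gaps_empty[OF bK, of "2 ^ v"] by simp
  then have "p_core (2 ^ v) lam = kap"
    using K(2) kap by (intro p_core_eqI[OF l(1) len]) auto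
  moreover have "card (upper_covers lam \<inter> odd_partitions_of (Suc n)) =
      card (upper_covers kap \<inter> odd_partitions_of (Suc (2 ^ v - 1)))"
    using card_covers_eq_card_odd_up[OF l, of N]
      card_covers_eq_card_odd_up[OF kap(1,4), of N] K(3) kap(3) \<open>2 ^ v \<le> Suc n\<close> by (simp add: N_def)
  ultimately show ?thesis using that[of kap] kap by simp
qed

section \<open>Odd covers of the core\<close>

lemma hook_subset_iff:
  "diagram ((a + 1) # replicate b 1) \<subseteq> diagram ((a' + 1) # replicate b' 1) \<longleftrightarrow> a \<le> a' \<and> b \<le> b'"
proof -
  have row: "row ((a + 1) # replicate b 1) i = (if i = 0 then a + 1 else if i \<le> b then 1 else 0)" for a b i
    by (cases i) (auto simp: row_def)
  have "(\<forall>i. (if i = 0 then a + 1 else if i \<le> b then 1 else 0) \<le>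
        (if i = 0 then a' + 1 else if i \<le> b' then 1 else (0::nat))) \<longleftrightarrow> a \<le> a' \<and> b \<le> b'"
    (is "(\<forall>i. ?P i) \<longleftrightarrow> _")
  proof
    assume *: "\<forall>i. ?P i"
    show "a \<le> a' \<and> b \<le> b'" using *[rule_format, of 0] *[rule_format, of b] by (auto split: if_splits)
  qed auto
  then show ?thesis unfolding diagram_subset_iff row .
qed

text \<open>The odd covers are the hooks of size \<open>2 ^ v\<close> containing \<open>kap\<close>.
  A hook grows in its arm or its leg; a nonempty partition that is not a hook contains
  \<open>(1, 1)\<close>, so no hook contains it. For \<open>v = 0\<close> the partition
  \<open>kap\<close> is empty, not a hook, and has the cover \<open>[1]\<close>.\<close>

lemma card_hook_covers:
  assumes kap: "is_partition kap" "sum_list kap = 2 ^ v - 1"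
  shows "card (upper_covers kap \<inter> odd_partitions_of (2 ^ v)) =
    (if v = 0 then 1 else if is_hook kap then 2 else 0)"
proof -
  let ?H = "{mu. is_hook mu \<and> sum_list mu = 2 ^ v \<and> diagram kap \<subseteq> diagram mu}"
  have "upper_covers kap \<inter> odd_partitions_of (2 ^ v) = ?H"
  proof (intro set_eqI iffI)
    fix mu assume mu: "mu \<in> upper_covers kap \<inter> odd_partitions_of (2 ^ v)"
    then have "sum_list mu = 2 ^ v" "is_partition mu" "diagram kap \<subseteq> diagram mu"
      by (auto simp: odd_partitions_of_def upper_covers_def)
    then show "mu \<in> ?H" using mu odd_power_two_iff_hook by blast
  next
    fix mu assume "mu \<in> ?H"
    then have mu: "is_hook mu" "sum_list mu = 2 ^ v" "diagram kap \<subseteq> diagram mu" by auto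
    note p = is_hook_partition[OF mu(1)]
    \<comment> \<open>The sizes differ by one, so containment is already a covering.\<close>
    have "card (diagram mu - diagram kap) = 1"
      using mu kap by (simp add: card_Diff_subset card_diagram)
    then obtain c where "diagram mu - diagram kap = {c}" by (auto simp: card_1_singleton_iff)
    then have "removes_rim_hook 1 mu kap" using removes_rim_hook_1I[OF p kap(1) mu(3)] by blast
    then show "mu \<in> upper_covers kap \<inter> odd_partitions_of (2 ^ v)"
      using upper_cover_iff[OF kap(1)] odd_power_two_iff_hook[OF p mu(2)] mu(1) by blast
  qed
  moreover have "?H = {[1]}" if "v = 0"
  proof -
    have "kap = []" using kap that sum_list_eq_0_partition by simp
    then have "diagram kap = {}" by (simp add: diagram_def)
    then show ?thesis using that
      by (auto simp: is_hook_def sum_list_replicate)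
  qed
  moreover have "card ?H = 2" if hook: "is_hook kap" and "v \<noteq> 0"
  proof -
    obtain a b where ab: "kap = (a + 1) # replicate b 1" using hook by (auto simp: is_hook_def)
    have size: "a + b + 2 = 2 ^ v"
    proof -
      have "a + 1 + b = 2 ^ v - 1" using kap(2) ab by (simp add: sum_list_replicate)
      then show ?thesis by linarith
    qed
    have "?H = {(a + 1 + 1) # replicate b 1, (a + 1) # replicate (b + 1) 1}"
    proof (intro set_eqI iffI)
      fix mu assume "mu \<in> ?H"
      then obtain a' b' where mu: "mu = (a' + 1) # replicate b' 1" "sum_list mu = 2 ^ v"
        "a \<le> a'" "b \<le> b'" using hook_subset_iff[of a b] by (auto simp: is_hook_def ab)
      then have "a' + b' = a + b + 1" using size by (simp add: sum_list_replicate)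
      then consider "a' = a + 1" "b' = b" | "a' = a" "b' = b + 1" using mu(3,4) by linarith
      then show "mu \<in> {(a + 1 + 1) # replicate b 1, (a + 1) # replicate (b + 1) 1}"
        using mu(1) by cases simp_all
    next
      fix mu assume "mu \<in> {(a + 1 + 1) # replicate b 1, (a + 1) # replicate (b + 1) 1}"
      then have "\<exists>a' b'. mu = (a' + 1) # replicate b' 1 \<and> a' + b' = a + b + 1 \<and> a \<le> a' \<and> b \<le> b'"
      proof
        assume "mu = (a + 1 + 1) # replicate b 1"
        then show ?thesis by (intro exI[of _ "a + 1"] exI[of _ b]) simp
      next
        assume "mu \<in> {(a + 1) # replicate (b + 1) 1}"
        then show ?thesis by (intro exI[of _ a] exI[of _ "b + 1"]) simp
      qed
      then obtain a' b' where mu: "mu = (a' + 1) # replicate b' 1" "a' + b' = a + b + 1"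
        "a \<le> a'" "b \<le> b'" by blast
      then have "is_hook mu" "diagram kap \<subseteq> diagram mu"
        using hook_subset_iff[of a b a' b'] by (auto simp: is_hook_def ab)
      then show "mu \<in> ?H" using mu size by (simp add: sum_list_replicate)
    qed
    moreover have "(a + 1 + 1) # replicate b 1 \<noteq> (a + 1) # replicate (b + 1) 1" by simp
    ultimately show ?thesis by (metis card_2_iff)
  qed
  moreover have "card ?H = 0" if nh: "\<not> is_hook kap" and "v \<noteq> 0"
  proof -
    have "2 \<le> (2::nat) ^ v" using \<open>v \<noteq> 0\<close> by (cases v) auto
    then have "0 < sum_list kap" using kap(2) by simp
    then have "diagram kap \<noteq> {}" by (metis card_diagram card.empty less_irrefl)
    then have "(0, 0) \<in> diagram kap" using diagram_down[OF kap(1)] by fastforce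
    then have "(1, 1) \<in> diagram kap" using nh is_hook_iff[OF kap(1)] by blast
    then have "?H = {}" using is_hook_iff is_hook_partition by blast
    then show ?thesis by (simp only: card.empty)
  qed
  moreover have "card {[1 :: nat]} = 1" by simp
  ultimately show ?thesis by metis
qed

lemma card_odd_covers:
  assumes "lam \<in> odd_partitions_of n" "v = multiplicity 2 (n + 1)"
  shows "card (upper_covers lam \<inter> odd_partitions_of (n + 1)) =
    (if even n then 1 else if is_hook (p_core (2 ^ v) lam) then 2 else 0)"
proof -
  obtain kap where kap: "is_partition kap" "sum_list kap = 2 ^ v - 1" "p_core (2 ^ v) lam = kap"
    "card (upper_covers lam \<inter> odd_partitions_of (n + 1)) =
      card (upper_covers kap \<inter> odd_partitions_of (2 ^ v))"
    using odd_covers_core[OF assms] .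
  have "v = 0 \<longleftrightarrow> even n"
    using assms(2) by (simp add: multiplicity_eq_zero_iff)
  then show ?thesis using kap card_hook_covers[OF kap(1,2)] by simp
qed

section \<open>The tree of odd partitions\<close>

lemma odd_partitions_of_iff:
  "lam \<in> odd_partitions_of n \<longleftrightarrow> lam \<in> odd_partitions \<and> sum_list lam = n"
  by (auto simp: odd_partitions_of_def)

lemma upper_cover_size:
  "is_partition lam \<Longrightarrow> mu \<in> upper_covers lam \<Longrightarrow> sum_list mu = Suc (sum_list lam)"
  using upper_cover_iff removes_rim_hook_size by fastforce

lemma odd_lower_unique:
  assumes mu: "mu \<in> odd_partitions" and lam: "lam \<in> odd_partitions" "mu \<in> upper_covers lam"
    and lam': "lam' \<in> odd_partitions" "mu \<in> upper_covers lam'"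
  shows "lam = lam'"
proof -
  define n N where "n = sum_list lam" and "N = Suc n"
  have p: "is_partition mu" "is_partition lam" "is_partition lam'"
    using mu lam lam' by (auto simp: odd_partitions_def)
  have s: "sum_list mu = Suc n" "sum_list lam = n" "sum_list lam' = n"
    using upper_cover_size[OF p(2) lam(2)] upper_cover_size[OF p(3) lam'(2)] by (auto simp: n_def)
  have len: "length mu \<le> N" "length lam \<le> N" "length lam' \<le> N"
    using length_le_sum_list[OF p(1)] length_le_sum_list[OF p(2)] length_le_sum_list[OF p(3)] s
    by (auto simp: N_def)
  have "unit_cover (bset N lam) (bset N mu)" "unit_cover (bset N lam') (bset N mu)"
    using lam(2) lam'(2) removes_rim_hook_iff_slide[OF p(1) len(1), of 1]
    by (simp_all add: upper_cover_iff p unit_cover_def)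
  moreover have "oddset N (Suc n) (bset N mu)" "oddset N n (bset N lam)" "oddset N n (bset N lam')"
    using mu lam lam' s p len by (simp_all add: odd_partitions_of_iff flip: odd_partition_iff)
  ultimately have "bset N lam = bset N lam'" using oddset_lower_unique by blast
  then show ?thesis using bset_inj p len by blast
qed

text \<open>An odd sum in the branching rule has an odd term.\<close>

lemma odd_lower_exists:
  assumes mu: "mu \<in> odd_partitions" "mu \<noteq> []"
  obtains lam where "lam \<in> odd_partitions" "mu \<in> upper_covers lam"
proof -
  have p: "is_partition mu" using mu by (simp add: odd_partitions_def)
  have pos: "0 < sum_list mu" using sum_list_eq_0_partition[OF p] mu(2) by (metis gr0I)
  have "odd (\<Sum>lam | removes_rim_hook 1 mu lam. num_syt lam)"
    using num_syt_recurrence[OF p pos] mu(1) by (simp add: odd_partitions_def)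
  then obtain lam where lam: "removes_rim_hook 1 mu lam" "odd (num_syt lam)"
    using dvd_sum[of "{lam. removes_rim_hook 1 mu lam}" 2 num_syt] by auto
  then have "is_partition lam" by (simp add: removes_rim_hook_def)
  then show ?thesis using that lam upper_cover_iff by (auto simp: odd_partitions_def)
qed

lemma Nil_odd: "[] \<in> odd_partitions"
  by (simp add: odd_partitions_def is_partition_def num_syt_Nil)

lemma odd_incomplete_binary_tree: "incomplete_binary_tree odd_partitions young_adj []"
proof -
  have sym: "young_adj mu lam" if "young_adj lam mu" for lam mu
    using that by (auto simp: young_adj_def)
  have graded: "sum_list mu = Suc (sum_list lam) \<or> sum_list lam = Suc (sum_list mu)"
    if "young_adj lam mu" for lam mu
    using that upper_cover_size by (auto simp: young_adj_def)
  have adjD: "lam \<in> upper_covers mu" if "young_adj lam mu" "sum_list lam = Suc (sum_list mu)" for lam mu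
    using that upper_cover_size[of lam mu] by (auto simp: young_adj_def)
  have unique: "mu = mu'" if "lam \<in> odd_partitions" "mu \<in> odd_partitions" "mu' \<in> odd_partitions"
    "young_adj lam mu" "young_adj lam mu'"
    "sum_list lam = Suc (sum_list mu)" "sum_list lam = Suc (sum_list mu')" for lam mu mu'
    using that adjD odd_lower_unique by blast
  have reach: "(\<lambda>a b. a \<in> odd_partitions \<and> b \<in> odd_partitions \<and> young_adj a b)\<^sup>*\<^sup>* lam []"
    if "lam \<in> odd_partitions" for lam
    using that
  proof (induction "sum_list lam" arbitrary: lam rule: less_induct)
    case less
    show ?case
    proof (cases "lam = []")
      case False
      then obtain mu where mu: "mu \<in> odd_partitions" "lam \<in> upper_covers mu"
        using odd_lower_exists less.prems by blast
      have p: "is_partition lam" "is_partition mu" using less.prems mu by (auto simp: odd_partitions_def)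
      then have "sum_list mu < sum_list lam" using upper_cover_size[OF p(2) mu(2)] by simp
      then show ?thesis
        using less.hyps[of mu] mu p less.prems by (auto simp: young_adj_def intro: converse_rtranclp_into_rtranclp)
    qed simp
  qed
  interpret graded_forest odd_partitions young_adj sum_list
    by standard (fact sym graded unique)+
  have tree: "tree_graph odd_partitions young_adj"
    unfolding tree_graph_def
    using connected_graphI[of "[]" odd_partitions young_adj, OF Nil_odd sym reach] acyclic_graded by blast
  have kids: "finite (children odd_partitions young_adj [] lam) \<and>
      card (children odd_partitions young_adj [] lam) \<le> (if even (sum_list lam) then 1 else 2)"
    if lam: "lam \<in> odd_partitions" for lam
  proof -
    let ?n = "sum_list lam"
    let ?C = "upper_covers lam \<inter> odd_partitions_of (?n + 1)"
    have "children odd_partitions young_adj [] lam \<subseteq>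
        {w \<in> odd_partitions. young_adj lam w \<and> sum_list w = Suc (sum_list lam)}"
      using children_graded[of "[]"] by simp
    also have "\<dots> \<subseteq> ?C" using adjD sym by (auto simp: odd_partitions_of_iff)
    finally have sub: "children odd_partitions young_adj [] lam \<subseteq> ?C" .
    have fin: "finite ?C"
    proof (rule finite_subset)
      show "?C \<subseteq> {mu. set mu \<subseteq> {..Suc ?n} \<and> length mu \<le> Suc ?n}"
      proof
        fix mu assume "mu \<in> ?C"
        then have "is_partition mu" "sum_list mu = Suc ?n"
          by (auto simp: odd_partitions_of_def odd_partitions_def)
        then show "mu \<in> {mu. set mu \<subseteq> {..Suc ?n} \<and> length mu \<le> Suc ?n}"
          using length_le_sum_list[of mu] member_le_sum_list[of _ mu] by auto
      qed
    qed (rule finite_lists_length_le, simp)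
    have "card (children odd_partitions young_adj [] lam) \<le> card ?C"
      by (rule card_mono[OF fin sub])
    also have "card ?C \<le> (if even ?n then 1 else 2)"
      using card_odd_covers[of lam ?n] lam by (simp add: odd_partitions_of_iff)
    finally show ?thesis
      using finite_subset[OF sub fin] by blast
  qed
  have two: "(if even (sum_list lam) then 1 else 2 :: nat) \<le> 2" for lam by simp
  \<comment> \<open>The root has even size 0, hence at most one child; this makes the tree
    incomplete.\<close>
  have root: "card (children odd_partitions young_adj [] []) < 2"
    using kids[OF Nil_odd] by simp
  show ?thesis
    unfolding incomplete_binary_tree_def binary_tree_def
  proof (intro conjI ballI bexI[of _ "[]"])
    fix lam assume "lam \<in> odd_partitions"
    then show "finite (children odd_partitions young_adj [] lam)"
      "card (children odd_partitions young_adj [] lam) \<le> 2"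
      using kids[of lam] order_trans[OF _ two] by blast+
  qed (fact tree Nil_odd root)+
qed

theorem theorem3p3:
  shows "(\<forall>lam n. lam \<in> odd_partitions_of n \<longrightarrow>
            (even n \<longrightarrow> (\<exists>!mu. mu \<in> upper_covers lam \<and> mu \<in> odd_partitions)) \<and>
            (odd n \<longrightarrow> (\<forall>v. v = multiplicity 2 (n + 1) \<longrightarrow>
               card (upper_covers lam \<inter> odd_partitions_of (n + 1)) =
                 (if is_hook (p_core (2 ^ v) lam) then 2 else 0))))
         \<and> incomplete_binary_tree odd_partitions young_adj []"
proof (intro conjI allI impI)
  fix lam n assume lam: "lam \<in> odd_partitions_of n" and "even n"
  then have "card (upper_covers lam \<inter> odd_partitions_of (n + 1)) = 1"
    using card_odd_covers[OF lam refl] by simp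
  then obtain mu where "upper_covers lam \<inter> odd_partitions_of (n + 1) = {mu}"
    by (auto simp: card_1_singleton_iff)
  \<comment> \<open>Covers of \<open>lam\<close> all have size \<open>n + 1\<close>, so restricting
    the size loses nothing.\<close>
  moreover have "upper_covers lam \<inter> odd_partitions_of (n + 1) = upper_covers lam \<inter> odd_partitions"
    using upper_cover_size[of lam] lam by (auto simp: odd_partitions_of_def odd_partitions_def)
  ultimately show "\<exists>!mu. mu \<in> upper_covers lam \<and> mu \<in> odd_partitions"
    by (intro ex1I[of _ mu]) auto
qed (use card_odd_covers odd_incomplete_binary_tree in auto)

end
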